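(* Let $n$ be a positive integer, let $S\subseteq\{2,3,\dots,n-1\}$ with $\operatorname{comp}(S)=(1,\delta_1,\delta_2,\dots,\delta_{k-1})$, and let $0<d_1\le d_2\le\cdots\le d_k$ be real numbers. Then $$n!\cdot\operatorname{Vol}\bigl(\mathcal{Z}_S(d_1,\dots,d_k)\bigr)=(-1)^{1+\delta_2+\delta_4+\cdots}\sum_{(b_1,\dots,b_n)\in\mathcal{P}_{\vec{a}(\operatorname{comp}(S))}}\prod_{i=1}^n(-1)^{b_i}d_{b_i}$$ $$=(-1)^{1+\delta_2+\delta_4+\cdots}\sum_{\alpha\in K_{\operatorname{comp}(S)}}\binom{n}{\alpha}(-1)^{\alpha_1+\alpha_3+\alpha_5+\cdots}d_1^{\alpha_1}d_2^{\alpha_2}\cdots d_k^{\alpha_k},$$ where $\binom{n}{\alpha}=\frac{n!}{\alpha_1!\cdots\alpha_k!}$ and in the sign $(-1)^{1+\delta_2+\delta_4+\cdots}$ the sum runs over the even-indexed $\delta_j$ with $j\le k-1$.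
   Context: For $S\subseteq\{2,\dots,n-1\}$, let $u_S=u_1u_2\cdots u_{n-1}$ be the word in non-commuting letters $\mathbf{a},\mathbf{b}$ with $u_i=\mathbf{a}$ if $i\notin S$ and $u_i=\mathbf{b}$ if $i\in S$. Write $u_S=\mathbf{a}^{\delta_1}\mathbf{b}^{\delta_2}\mathbf{a}^{\delta_3}\mathbf{b}^{\delta_4}\cdots\mathbf{?}^{\delta_{k-1}}$ with all $\delta_j\ge1$ (so $\delta_1\ge 1$ since $1\notin S$), and set $\operatorname{comp}(S)=(1,\delta_1,\dots,\delta_{k-1})$, a composition of $n$ with $k$ parts. The polytope $\mathcal{Z}_S(d_1,\dots,d_k)\subseteq\mathbb{R}^n$ is the set of $(x_1,\dots,x_n)$ with $x_j\ge0$ for all $j\in[n]$, $x_1\le d_1$, and, for $1\le i\le k-1$, $$x_{\delta_1+\cdots+\delta_{i-1}+1}+x_{\delta_1+\cdots+\delta_{i-1}+2}+\cdots+x_{\delta_1+\cdots+\delta_i+1}\le d_{i+1}.$$ For a composition $\gamma=(\gamma_1,\dots,\gamma_k)$ of $n$, $\vec{a}(\gamma)$ is the sequence consisting of $\gamma_1$ ones, then $\gamma_2$ twos, then $\gamma_3$ threes, etc. (length $n$), and $K_\gamma$ is the set of sequences $\alpha=(\alpha_1,\dots,\alpha_k)$ of non-negative integers with $\alpha_1+\cdots+\alpha_k=n$ and $\alpha_1+\cdots+\alpha_i\ge\gamma_1+\cdots+\gamma_i$ for all $i$. For a non-decreasing sequence $\vec{a}=(a_1,\dots,a_n)$ of positive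 integers, a sequence $(b_1,\dots,b_n)$ of positive integers is an $\vec{a}$-parking function if its increasing rearrangement $b'_1\le\cdots\le b'_n$ satisfies $b'_i\le a_i$ for all $i$; $\mathcal{P}_{\vec{a}}$ is the set of these. *)

theory Defs
  imports "HOL-Analysis.Analysis"
begin

datatype letter = Letter_a | Letter_b

text \<open>
  The word \<open>u\<^sub>S = u\<^sub>1 \<dots> u\<^sub>n\<^sub>-\<^sub>1\<close>; the set \<open>S\<close> is meant to be a subset of \<open>{2..n - 1}\<close>.
\<close>

definition u_word :: "nat \<Rightarrow> nat set \<Rightarrow> letter list" where
  "u_word n S = map (\<lambda>i. if i \<in> S then Letter_b else Letter_a) [1..<n]"

text \<open>\<open>alternating_word x y [m\<^sub>1, m\<^sub>2, m\<^sub>3, \<dots>] = x^m\<^sub>1 y^m\<^sub>2 x^m\<^sub>3 \<dots>\<close>\<close>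

primrec alternating_word :: "'a \<Rightarrow> 'a \<Rightarrow> nat list \<Rightarrow> 'a list" where
  "alternating_word x y [] = []"
| "alternating_word x y (m # ms) = replicate m x @ alternating_word y x ms"

lemma alternating_word_unique:
  assumes "x \<noteq> y" "\<forall>m\<in>set ms. 1 \<le> m" "\<forall>m\<in>set ns. 1 \<le> m"
    and "alternating_word x y ms = alternating_word x y ns"
  shows "ms = ns"
  using assms
proof (induction ms arbitrary: ns x y)
  case Nil
  then show ?case by (cases ns) auto
next
  case (Cons m ms)
  have run: "takeWhile ((=) c) (replicate k c @ alternating_word d c ks) = replicate k c"
    if "c \<noteq> d" "\<forall>m\<in>set ks. 1 \<le> m" for c d :: 'a and k ks
  proof -
    have "takeWhile ((=) c) (alternating_word d c ks) = []"
    proof (cases ks)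
      case (Cons l ls)
      with that obtain l' where "l = Suc l'" by (cases l) auto
      with Cons that show ?thesis by simp
    qed simp
    then show ?thesis by (simp add: takeWhile_append)
  qed
  from Cons.prems(2,4) obtain k ns' where ns: "ns = k # ns'"
    by (cases ns) auto
  have eq: "replicate m x @ alternating_word y x ms = replicate k x @ alternating_word y x ns'"
    using Cons.prems(4) ns by simp
  from arg_cong[OF this, of "takeWhile ((=) x)"]
  have "replicate m x = replicate k x"
    using run[of x y ms m] run[of x y ns' k] Cons.prems ns by simp
  then have "m = k" by (metis length_replicate)
  with eq have "alternating_word y x ms = alternating_word y x ns'" by simp
  moreover have "y \<noteq> x" "\<forall>m\<in>set ms. 1 \<le> m" "\<forall>m\<in>set ns'. 1 \<le> m"
    using Cons.prems ns by auto
  ultimately have "ms = ns'" by (intro Cons.IH)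
  with ns \<open>m = k\<close> show ?case by simp
qed

lemma alternating_word_exists:
  assumes "set w \<subseteq> {x, y}" "w = [] \<or> hd w = x"
  shows "\<exists>ms. (\<forall>m\<in>set ms. 1 \<le> m) \<and> w = alternating_word x y ms"
  using assms
proof (induction w arbitrary: x y)
  case Nil
  show ?case by (rule exI[of _ "[]"]) simp
next
  case (Cons c w)
  then have c: "c = x" by simp
  show ?case
  proof (cases "w = [] \<or> hd w = x")
    case True
    moreover have "set w \<subseteq> {x, y}" using Cons.prems by simp
    ultimately obtain ms where ms: "\<forall>m\<in>set ms. 1 \<le> m" "w = alternating_word x y ms"
      using Cons.IH[of x y] by blast
    show ?thesis
    proof (cases ms)
      case Nil
      with ms c show ?thesis by (intro exI[of _ "[1]"]) simp
    next
      case (Cons l ls)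
      with ms c show ?thesis by (intro exI[of _ "Suc l # ls"]) simp
    qed
  next
    case False
    from Cons.prems have sub: "set w \<subseteq> {y, x}" by auto
    with False have "hd w = y" by (cases w) auto
    with sub obtain ms where "\<forall>m\<in>set ms. 1 \<le> m" "w = alternating_word y x ms"
      using Cons.IH[of y x] by blast
    with c show ?thesis by (intro exI[of _ "1 # ms"]) simp
  qed
qed

definition comp_of :: "nat \<Rightarrow> nat set \<Rightarrow> nat list" where
  "comp_of n S =
     1 # (THE \<delta>. (\<forall>m\<in>set \<delta>. 1 \<le> m) \<and> u_word n S = alternating_word Letter_a Letter_b \<delta>)"

lemma comp_of_well_defined:
  assumes "1 \<notin> S"
  shows "\<exists>!\<delta>. (\<forall>m\<in>set \<delta>. 1 \<le> m) \<and> u_word n S = alternating_word Letter_a Letter_b \<delta>"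
proof -
  have "set (u_word n S) \<subseteq> {Letter_a, Letter_b}"
    by (auto simp: u_word_def)
  moreover have "u_word n S = [] \<or> hd (u_word n S) = Letter_a"
  proof (cases "1 < n")
    case True
    then have "[1..<n] = 1 # [Suc 1..<n]" by (rule upt_conv_Cons)
    with assms show ?thesis by (simp add: u_word_def)
  qed (simp add: u_word_def)
  ultimately obtain \<delta> where
    \<delta>: "\<forall>m\<in>set \<delta>. 1 \<le> m" "u_word n S = alternating_word Letter_a Letter_b \<delta>"
    using alternating_word_exists[of "u_word n S" Letter_a Letter_b] by blast
  show ?thesis
  proof (rule ex1I[of _ \<delta>])
    fix \<epsilon>
    assume "(\<forall>m\<in>set \<epsilon>. 1 \<le> m) \<and> u_word n S = alternating_word Letter_a Letter_b \<epsilon>"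
    with \<delta> show "\<epsilon> = \<delta>"
      by (intro alternating_word_unique[OF letter.distinct(1)]) simp_all
  qed (use \<delta> in simp)
qed

text \<open>
  Points of \<open>\<real>\<^sup>n\<close> are functions on \<open>{1..n}\<close> (extended by \<open>undefined\<close>), so that \<open>n\<close> can be a
  variable; the corresponding Lebesgue measure is the product measure \<open>lebesgue_n n\<close>.
  Since lists are indexed from 0, \<open>\<delta>\<^sub>j\<close> is \<open>\<delta> ! (j - 1)\<close> and
  \<open>\<delta>\<^sub>1 + \<dots> + \<delta>\<^sub>i\<close> is \<open>sum_list (take i \<delta>)\<close>.
\<close>

definition lebesgue_n :: "nat \<Rightarrow> (nat \<Rightarrow> real) measure" where
  "lebesgue_n n = Pi\<^sub>M {1..n} (\<lambda>_. lborel)"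

definition Z_polytope :: "nat \<Rightarrow> nat set \<Rightarrow> (nat \<Rightarrow> real) \<Rightarrow> (nat \<Rightarrow> real) set" where
  "Z_polytope n S d = (let \<delta> = tl (comp_of n S) in
     {x \<in> {1..n} \<rightarrow>\<^sub>E UNIV.
        (\<forall>j\<in>{1..n}. 0 \<le> x j) \<and> x 1 \<le> d 1 \<and>
        (\<forall>i\<in>{1..length \<delta>}.
           (\<Sum>j = sum_list (take (i - 1) \<delta>) + 1..sum_list (take i \<delta>) + 1. x j) \<le> d (i + 1))})"

definition a_vec :: "nat list \<Rightarrow> nat list" where
  "a_vec \<gamma> = concat (map (\<lambda>i. replicate (\<gamma> ! (i - 1)) i) [1..<length \<gamma> + 1])"

definition parking_functions :: "nat list \<Rightarrow> nat list set" where
  "parking_functions a =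
     {b. length b = length a \<and> (\<forall>x\<in>set b. 1 \<le> x) \<and> (\<forall>i<length a. sort b ! i \<le> a ! i)}"

definition K_set :: "nat list \<Rightarrow> nat list set" where
  "K_set \<gamma> =
     {\<alpha>. length \<alpha> = length \<gamma> \<and> sum_list \<alpha> = sum_list \<gamma> \<and>
         (\<forall>i\<in>{1..length \<gamma>}. sum_list (take i \<gamma>) \<le> sum_list (take i \<alpha>))}"

definition multinomial :: "nat \<Rightarrow> nat list \<Rightarrow> real" where
  "multinomial n \<alpha> = fact n / (\<Prod>i<length \<alpha>. fact (\<alpha> ! i))"

lemma finite_parking_functions: "finite (parking_functions a)"
proof -
  have "parking_functions a \<subseteq> {b. set b \<subseteq> {..Max (set a)} \<and> length b = length a}"
  proof safe
    fix b x assume b: "b \<in> parking_functions a" and "x \<in> set b"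
    then obtain i where i: "i < length (sort b)" "x = sort b ! i"
      using in_set_conv_nth[of x "sort b"] by auto
    with b have "i < length a" "x \<le> a ! i" by (auto simp: parking_functions_def)
    moreover from this have "a ! i \<le> Max (set a)" by (intro Max_ge) simp_all
    ultimately show "x \<le> Max (set a)" by linarith
  qed (simp add: parking_functions_def)
  then show ?thesis by (rule finite_subset) (simp add: finite_lists_length_eq)
qed

lemma finite_K_set: "finite (K_set \<gamma>)"
proof -
  have "K_set \<gamma> \<subseteq> {\<alpha>. set \<alpha> \<subseteq> {..sum_list \<gamma>} \<and> length \<alpha> = length \<gamma>}"
  proof safe
    fix \<alpha> x assume "\<alpha> \<in> K_set \<gamma>" "x \<in> set \<alpha>"
    then show "x \<le> sum_list \<gamma>"
      using member_le_sum_list[of x \<alpha>] by (simp add: K_set_def)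
  qed (simp add: K_set_def)
  then show ?thesis by (rule finite_subset) (simp add: finite_lists_length_eq)
qed

end

theory Submission
  imports Defs "HOL-Combinatorics.Multiset_Permutations"
begin

text \<open>
  Call the blocks of coordinates whose sums are bounded by \<open>d\<^sub>1, d\<^sub>2, \<dots>\<close> in turn; consecutive blocks
  share one coordinate. Push Lebesgue measure on the polytope forward to the running sum of the
  current block: a new coordinate inside a block replaces the density \<open>f\<close> by its antiderivative
  \<open>J f\<close>, and a coordinate that closes a block of bound \<open>c\<close> and opens the next replaces \<open>f\<close> by
  \<open>t \<mapsto> (J f) (c - t)\<close>. Since \<open>J\<close> applied to a reflected function is
  \<open>\<integral>\<^sub>0\<^sup>D G (c - t) dt = (J G) c - (J G) (c - D)\<close>, the iterated antiderivatives \<open>J\<^sup>r f\<close> of one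
  block are polynomials in \<open>D\<close>, up to a term in \<open>c - D\<close> which vanishes as soon as \<open>D \<ge> c\<close>; their
  coefficients are values at \<open>c\<close> for the previous block. As the \<open>d\<^sub>i\<close> increase, unrolling this
  recursion gives the alternating sum over \<open>K\<^sub>\<gamma>\<close>, where the exponent of \<open>d\<^sub>i\<close> is \<open>\<alpha>\<^sub>i\<close>. A sequence is
  an \<open>a(\<gamma>)\<close>-parking function iff its content vector lies in \<open>K\<^sub>\<gamma>\<close>, and a multinomial coefficient
  counts the sequences with a given content.
\<close>

subsection \<open>Iterated antiderivatives\<close>

text \<open>
  \<open>run_density d gs r\<close> is the density of the running sum after the blocks with sizes \<open>rev gs\<close> (the
  leading 1 of the composition included) and \<open>r\<close> further coordinates of the next block. The value on
  \<open>[]\<close> is \<open>J\<^sup>r\<close> of the Dirac mass at 0, meaningful for \<open>r \<ge> 1\<close> only.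
\<close>

fun run_density :: "(nat \<Rightarrow> real) \<Rightarrow> nat list \<Rightarrow> nat \<Rightarrow> real \<Rightarrow> real" where
  "run_density d [] r t = (if t < 0 then 0 else t ^ (r - 1) / fact (r - 1))"
| "run_density d (g # gs) r t = (if t < 0 then 0 else
     (\<Sum>j<r. (- 1) ^ j * run_density d gs (g + 1 + j) (d (length (g # gs))) * (t ^ (r - 1 - j) / fact (r - 1 - j)))
     + (- 1) ^ r * run_density d gs (g + r) (d (length (g # gs)) - t))"

declare run_density.simps [simp del]

lemma run_density_neg: "t < 0 \<Longrightarrow> run_density d gs r t = 0"
  by (cases gs) (simp_all add: run_density.simps)

lemma run_density_Cons_0:
  "run_density d (g # gs) 0 t = (if t < 0 then 0 else run_density d gs g (d (length (g # gs)) - t))"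
  by (simp add: run_density.simps)

text \<open>The antiderivatives are normalised to vanish at 0. After a closed block only the last
  term, j = r, of the sum survives at t = 0, and it cancels the reflected term. The hypothesis
  excludes \<open>run_density d [] 1\<close>, the Heaviside function, whose value at 0 is 1.\<close>

lemma run_density_at_0:
  assumes "gs \<noteq> [] \<or> r \<ge> 1"
  shows "run_density d gs (Suc r) 0 = 0"
proof (cases gs)
  case Nil
  with assms show ?thesis by (simp add: run_density.simps power_0_left)
next
  case (Cons g gs')
  have "(\<Sum>j<r. (- 1) ^ j * run_density d gs' (g + 1 + j) c * (0 ^ (r - j) / fact (r - j))) = 0" for c
    by (rule sum.neutral) (simp add: power_0_left)
  then show ?thesis using Cons by (simp add: run_density.simps)
qed

text \<open>For t above the bound the reflected argument is negative; at equality the reflected term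
  is a value at 0, which vanishes because g \<ge> 1. What remains is a polynomial in t, and this is
  what gets unrolled later.\<close>

lemma run_density_beyond:
  assumes "g \<ge> 1" and "t \<ge> d (length (g # gs))" and "t \<ge> 0"
  shows "run_density d (g # gs) (Suc r) t
    = (\<Sum>j<Suc r. (- 1) ^ j * run_density d gs (g + 1 + j) (d (length (g # gs))) * (t ^ (r - j) / fact (r - j)))"
proof -
  have "run_density d gs (g + Suc r) (d (length (g # gs)) - t) = 0"
    using assms run_density_at_0[of gs "g + r" d] run_density_neg[of "d (length (g # gs)) - t" d gs "g + Suc r"]
    by (cases "t = d (length (g # gs))") auto
  then show ?thesis using assms by (simp add: run_density.simps)
qed

lemma run_density_Cons_0_beyond:
  assumes "t > d (length (g # gs))"
  shows "run_density d (g # gs) 0 t = 0"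
  using assms by (simp add: run_density_Cons_0 run_density_neg)

text \<open>The formula for t \<ge> 0 without the cutoff at 0, so that it can be differentiated
  everywhere off a finite set. It is the r-fold antiderivative from 0 of a reflected density G(c -
  t): each integration leaves a constant at c, which later integrations turn into a multiple of t^s
  / s!, and flips the sign of the reflected term.\<close>

definition run_poly :: "(nat \<Rightarrow> real) \<Rightarrow> nat \<Rightarrow> nat list \<Rightarrow> nat \<Rightarrow> real \<Rightarrow> real" where
  "run_poly d g gs r t =
     (\<Sum>j<r. (- 1) ^ j * run_density d gs (g + 1 + j) (d (length (g # gs))) * (t ^ (r - 1 - j) / fact (r - 1 - j)))
     + (- 1) ^ r * run_density d gs (g + r) (d (length (g # gs)) - t)"

lemma run_density_Cons: "run_density d (g # gs) r t = (if t < 0 then 0 else run_poly d g gs r t)"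
  by (simp add: run_density.simps run_poly_def)

text \<open>Since the value at 0 is 0, the cutoff amounts to replacing t by max t 0, which exhibits
  the density as a composition of continuous functions.\<close>

lemma continuous_on_run_density:
  assumes "\<forall>g\<in>set gs. g \<ge> 1" and "gs \<noteq> [] \<or> r \<ge> 1"
  shows "continuous_on UNIV (run_density d gs (Suc r))"
  using assms
proof (induction gs arbitrary: r)
  case Nil
  have "run_density d [] (Suc r) = (\<lambda>t. (max t 0) ^ r / fact r)"
    using Nil by (auto simp: run_density.simps fun_eq_iff max_def power_0_left)
  then show ?case by (auto intro!: continuous_intros)
next
  case (Cons g gs)
  have "continuous_on UNIV (run_density d gs (g + Suc r))"
    using Cons.IH[of "g + r"] Cons.prems by simp
  then have "continuous_on UNIV (\<lambda>t. run_density d gs (g + Suc r) (d (length (g # gs)) - max t 0))"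
    by (rule continuous_on_compose2) (auto intro!: continuous_intros)
  then have "continuous_on UNIV (\<lambda>t. run_poly d g gs (Suc r) (max t 0))"
    unfolding run_poly_def by (intro continuous_intros) auto
  also have "(\<lambda>t. run_poly d g gs (Suc r) (max t 0)) = run_density d (g # gs) (Suc r)"
    using run_density_at_0[of "g # gs" r d]
    by (auto simp: fun_eq_iff max_def run_density_Cons)
  finally show ?case .
qed

lemma DERIV_power_div_fact:
  "((\<lambda>t. t ^ Suc s / fact (Suc s)) has_real_derivative t ^ s / fact s) (at (t::real))"
proof -
  have "((\<lambda>t. t ^ Suc s / fact (Suc s)) has_real_derivative real (Suc s) * t ^ s / fact (Suc s)) (at t)"
    using DERIV_cdivide[OF DERIV_pow[of "Suc s" t UNIV], of "fact (Suc s)"]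
    by (simp only: diff_Suc_Suc diff_zero)
  also have "real (Suc s) * t ^ s / fact (Suc s) = t ^ s / fact s"
    by (simp add: fact_Suc del: of_nat_Suc)
  finally show ?thesis .
qed

text \<open>Each power drops by one degree, the constant term j = r disappears, and the inner
  derivative -1 of the reflection turns (-1)^(r+1) into (-1)^r. Differentiability of the previous
  density is required only at the reflected point.\<close>

lemma run_poly_has_derivative:
  assumes "(run_density d gs (g + Suc r) has_real_derivative run_density d gs (g + r) (d (length (g # gs)) - t))
    (at (d (length (g # gs)) - t))"
  shows "(run_poly d g gs (Suc r) has_real_derivative run_poly d g gs r t) (at t)"
proof -
  let ?C = "\<lambda>j. (- 1) ^ j * run_density d gs (g + 1 + j) (d (length (g # gs)))"
  have pow: "((\<lambda>t. ?C j * (t ^ (r - j) / fact (r - j))) has_real_derivative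
      (if j < r then ?C j * (t ^ (r - 1 - j) / fact (r - 1 - j)) else 0)) (at t)" if "j < Suc r" for j
  proof (cases "j < r")
    case True
    then obtain s where s: "r - j = Suc s" "r - 1 - j = s" by (metis Suc_diff_Suc diff_Suc_eq_diff_pred diff_commute One_nat_def)
    from DERIV_power_div_fact have "((\<lambda>t. ?C j * (t ^ Suc s / fact (Suc s))) has_real_derivative ?C j * (t ^ s / fact s)) (at t)"
      by (rule DERIV_cmult)
    then show ?thesis using True s by simp
  qed (use that in auto)
  have sum: "((\<lambda>t. \<Sum>j<Suc r. ?C j * (t ^ (r - j) / fact (r - j))) has_real_derivative
      (\<Sum>j<Suc r. if j < r then ?C j * (t ^ (r - 1 - j) / fact (r - 1 - j)) else 0)) (at t)"
    by (rule DERIV_sum) (use pow in auto)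
  have comp: "((\<lambda>t. run_density d gs (g + Suc r) (d (length (g # gs)) - t)) has_real_derivative
      run_density d gs (g + r) (d (length (g # gs)) - t) * (- 1)) (at t)"
    by (rule DERIV_chain2[where f = "run_density d gs (g + Suc r)" and g = "\<lambda>t. d (length (g # gs)) - t", OF assms])
      (auto intro!: derivative_eq_intros)
  from DERIV_add[OF sum DERIV_cmult[OF comp, of "(- 1) ^ Suc r"]]
  show ?thesis by (simp add: run_poly_def[abs_def])
qed

text \<open>The exceptional points are 0, where the cutoff sits, and the reflections c - u of the
  exceptional points u of the previous block.\<close>

lemma run_density_has_derivative:
  assumes "\<forall>g\<in>set gs. g \<ge> 1" and "gs \<noteq> [] \<or> r \<ge> 1"
  shows "\<exists>F. finite F \<and> (\<forall>t. t \<notin> F \<longrightarrow>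
    (run_density d gs (Suc r) has_real_derivative run_density d gs r t) (at t))"
  using assms
proof (induction gs arbitrary: r)
  case Nil
  then obtain s where r: "r = Suc s" by (cases r) auto
  have "(run_density d [] (Suc r) has_real_derivative run_density d [] r t) (at t)" if "t \<noteq> 0" for t
  proof (cases "t < 0")
    case True
    have "((\<lambda>t. 0) has_real_derivative 0) (at t)" by simp
    then have "(run_density d [] (Suc r) has_real_derivative 0) (at t)"
      by (rule has_field_derivative_transform_within_open[where S = "{..<0}"])
         (use True in \<open>auto simp: run_density_neg\<close>)
    with True show ?thesis by (simp add: run_density_neg)
  next
    case False
    from DERIV_power_div_fact have "(run_density d [] (Suc r) has_real_derivative t ^ s / fact s) (at t)"
      by (rule has_field_derivative_transform_within_open[where S = "{0<..}"])
         (use False that r in \<open>auto simp: run_density.simps\<close>)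
    with False r show ?thesis by (simp add: run_density.simps)
  qed
  then show ?case by (intro exI[of _ "{0}"]) auto
next
  case (Cons g gs)
  let ?c = "d (length (g # gs))"
  obtain F where F: "finite F" "\<And>t. t \<notin> F \<Longrightarrow>
      (run_density d gs (Suc (g + r)) has_real_derivative run_density d gs (g + r) t) (at t)"
    using Cons.IH[of "g + r"] Cons.prems by auto
  have "(run_density d (g # gs) (Suc r) has_real_derivative run_density d (g # gs) r t) (at t)"
    if "t \<notin> insert 0 ((\<lambda>u. ?c - u) ` F)" for t
  proof (cases "t < 0")
    case True
    have "((\<lambda>t. 0) has_real_derivative 0) (at t)" by simp
    then have "(run_density d (g # gs) (Suc r) has_real_derivative 0) (at t)"
      by (rule has_field_derivative_transform_within_open[where S = "{..<0}"])
         (use True in \<open>auto simp: run_density_neg\<close>)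
    with True show ?thesis by (simp add: run_density_neg)
  next
    case False
    from that have "?c - t \<notin> F"
      by (metis insertCI imageI diff_diff_eq2 add_diff_cancel_left')
    then have "(run_poly d g gs (Suc r) has_real_derivative run_poly d g gs r t) (at t)"
      by (intro run_poly_has_derivative) (use F in auto)
    then have "(run_density d (g # gs) (Suc r) has_real_derivative run_poly d g gs r t) (at t)"
      by (rule has_field_derivative_transform_within_open[where S = "{0<..}"])
         (use False that in \<open>auto simp: run_density_Cons\<close>)
    with False show ?thesis by (simp add: run_density_Cons)
  qed
  with F(1) show ?case by (intro exI[of _ "insert 0 ((\<lambda>u. ?c - u) ` F)"]) auto
qed

text \<open>Fundamental theorem of calculus with finitely many exceptional points: the candidate
  antiderivative is continuous, has the right derivative off a finite set and vanishes at 0.\<close>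

lemma run_density_has_integral:
  assumes "\<forall>g\<in>set gs. g \<ge> 1" and "gs \<noteq> [] \<or> r \<ge> 1" and "u \<ge> 0"
  shows "(run_density d gs r has_integral run_density d gs (Suc r) u) {0..u}"
proof -
  obtain F where F: "finite F" "\<And>t. t \<notin> F \<Longrightarrow>
      (run_density d gs (Suc r) has_real_derivative run_density d gs r t) (at t)"
    using run_density_has_derivative[OF assms(1,2)] by auto
  have "(run_density d gs r has_integral run_density d gs (Suc r) u - run_density d gs (Suc r) 0) {0..u}"
  proof (rule fundamental_theorem_of_calculus_strong[OF F(1) assms(3)])
    show "(run_density d gs (Suc r) has_vector_derivative run_density d gs r x) (at x)" if "x \<in> {0..u} - F" for x
      using F(2)[of x] that by (simp add: has_real_derivative_iff_has_vector_derivative)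
    show "continuous_on {0..u} (run_density d gs (Suc r))"
      using continuous_on_run_density[OF assms(1,2)] continuous_on_subset by blast
  qed
  then show ?thesis using run_density_at_0[OF assms(2), of d] by simp
qed

text \<open>The alternating formula hides the sign. Nonnegativity passes from one block to the next
  by reflection (r = 0), and from r to r + 1 by integration.\<close>

lemma run_density_nonneg:
  assumes "\<forall>g\<in>set gs. g \<ge> 1"
  shows "run_density d gs r t \<ge> 0"
  using assms
proof (induction gs arbitrary: r t)
  case Nil
  show ?case by (simp add: run_density.simps)
next
  case (Cons g gs)
  show ?case
  proof (induction r arbitrary: t)
    case 0
    show ?case using Cons by (simp add: run_density_Cons_0)
  next
    case (Suc r)
    show ?case
    proof (cases "t < 0")
      case False
      then show ?thesis
        using has_integral_nonneg[OF run_density_has_integral[of "g # gs" r t d]] Suc Cons.prems by auto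
    qed (simp add: run_density_neg)
  qed
qed

lemma borel_measurable_run_density [measurable]: "run_density d gs r \<in> borel_measurable borel"
proof (induction gs arbitrary: r)
  case Nil
  show ?case unfolding run_density.simps[abs_def] by measurable
next
  case (Cons g gs)
  note [measurable] = Cons
  show ?case unfolding run_density.simps[abs_def] by measurable
qed

text \<open>The same antiderivative with lower limit minus infinity, since the densities vanish on
  negative numbers. This is the form of the assumption on \<open>G\<close> in
  \<open>pushes_to_free\<close> and \<open>pushes_to_cap\<close>.\<close>

lemma nn_integral_run_density:
  assumes "\<forall>g\<in>set gs. g \<ge> 1" and "gs \<noteq> [] \<or> r \<ge> 1"
  shows "(\<integral>\<^sup>+t. ennreal (run_density d gs r t) * indicator {..u} t \<partial>lborel) = ennreal (run_density d gs (Suc r) u)"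
proof (cases "u < 0")
  case True
  have "(\<integral>\<^sup>+t. ennreal (run_density d gs r t) * indicator {..u} t \<partial>lborel) = (\<integral>\<^sup>+t. 0 \<partial>(lborel :: real measure))"
    using True by (intro nn_integral_cong) (auto simp: indicator_def run_density_neg)
  then show ?thesis using True by (simp add: run_density_neg)
next
  case False
  have "(\<integral>\<^sup>+t. ennreal (run_density d gs r t) * indicator {..u} t \<partial>lborel)
      = (\<integral>\<^sup>+t. ennreal (run_density d gs r t * indicator {0..u} t) \<partial>lborel)"
    by (intro nn_integral_cong) (auto simp: indicator_def run_density_neg)
  also have "\<dots> = ennreal (run_density d gs (Suc r) u)"
  proof (rule nn_integral_has_integral_lborel)
    have "((\<lambda>t. if t \<in> {0..u} then run_density d gs r t else 0) has_integral run_density d gs (Suc r) u) UNIV"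
      using run_density_has_integral[OF assms, of u d] False by (simp only: has_integral_restrict_UNIV)
    also have "(\<lambda>t. if t \<in> {0..u} then run_density d gs r t else 0) = (\<lambda>t. run_density d gs r t * indicator {0..u} t)"
      by (auto simp: indicator_def)
    finally show "((\<lambda>t. run_density d gs r t * indicator {0..u} t) has_integral run_density d gs (Suc r) u) UNIV" .
  qed (use run_density_nonneg[OF assms(1)] in auto)
  finally show ?thesis .
qed

subsection \<open>Densities of running sums\<close>

text \<open>\<open>g\<close> is the density of the image under \<open>\<phi>\<close> of Lebesgue measure restricted to \<open>A\<close>.\<close>

definition pushes_to :: "nat set \<Rightarrow> (nat \<Rightarrow> real) set \<Rightarrow> ((nat \<Rightarrow> real) \<Rightarrow> real) \<Rightarrow> (real \<Rightarrow> real) \<Rightarrow> bool" where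
  "pushes_to I A \<phi> g \<longleftrightarrow> A \<in> sets (Pi\<^sub>M I (\<lambda>_. lborel)) \<and> \<phi> \<in> borel_measurable (Pi\<^sub>M I (\<lambda>_. lborel))
     \<and> g \<in> borel_measurable borel
     \<and> (\<forall>h \<in> borel_measurable borel. (\<integral>\<^sup>+x. indicator A x * h (\<phi> x) \<partial>Pi\<^sub>M I (\<lambda>_. lborel))
          = (\<integral>\<^sup>+t. ennreal (g t) * h t \<partial>lborel))"

text \<open>Fubini on \<open>lborel\<close> asks for measurability on the product of the two
  measures; this moves the goal to the product of Borel spaces.\<close>

lemma borel_measurable_lborel_pair:
  "borel_measurable ((lborel :: real measure) \<Otimes>\<^sub>M (lborel :: real measure)) = borel_measurable (borel \<Otimes>\<^sub>M borel)"
  by (rule measurable_cong_sets) (simp_all cong: sets_pair_measure_cong)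

text \<open>By Tonelli the new coordinate is integrated innermost. The result depends on the old
  coordinates only through \<phi>, so the pushforward identity applies to the test function s
  \<mapsto> \<integral> k s y dy.\<close>

lemma pushes_to_insert:
  fixes k :: "real \<Rightarrow> real \<Rightarrow> ennreal"
  assumes "pushes_to I A \<phi> g" "finite I" "i \<notin> I"
    and [measurable]: "case_prod k \<in> borel_measurable (borel \<Otimes>\<^sub>M borel)"
  shows "(\<integral>\<^sup>+x. indicator A (restrict x I) * k (\<phi> (restrict x I)) (x i) \<partial>Pi\<^sub>M (insert i I) (\<lambda>_. lborel))
    = (\<integral>\<^sup>+s. ennreal (g s) * (\<integral>\<^sup>+y. k s y \<partial>lborel) \<partial>lborel)"
proof -
  interpret product_sigma_finite "\<lambda>_::nat. lborel :: real measure" ..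
  note [measurable] = measurable_restrict_subset[OF subset_insertI]
  from assms(1) have [measurable]: "A \<in> sets (Pi\<^sub>M I (\<lambda>_. lborel))"
    "\<phi> \<in> borel_measurable (Pi\<^sub>M I (\<lambda>_. lborel))" "g \<in> borel_measurable borel"
    by (simp_all add: pushes_to_def)
  have "(\<integral>\<^sup>+x. indicator A (restrict x I) * k (\<phi> (restrict x I)) (x i) \<partial>Pi\<^sub>M (insert i I) (\<lambda>_. lborel))
    = (\<integral>\<^sup>+x. \<integral>\<^sup>+y. indicator A (restrict (x(i := y)) I) * k (\<phi> (restrict (x(i := y)) I)) y \<partial>lborel
        \<partial>Pi\<^sub>M I (\<lambda>_. lborel))"
    by (subst product_nn_integral_insert) (use assms in \<open>auto intro!: nn_integral_cong\<close>)
  also have "\<dots> = (\<integral>\<^sup>+x. indicator A x * (\<integral>\<^sup>+y. k (\<phi> x) y \<partial>lborel) \<partial>Pi\<^sub>M I (\<lambda>_. lborel))"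
  proof (intro nn_integral_cong)
    fix x assume x: "x \<in> space (Pi\<^sub>M I (\<lambda>_. lborel :: real measure))"
    \<comment> \<open>Points of the product space are \<open>undefined\<close> outside
      \<open>I\<close>, so restricting after the update at \<open>i\<close> recovers x
      itself.\<close>
    have "restrict (x(i := y)) I = x" for y
      using x assms(3) by (auto simp: space_PiM PiE_def extensional_def fun_eq_iff)
    then show "(\<integral>\<^sup>+y. indicator A (restrict (x(i := y)) I) * k (\<phi> (restrict (x(i := y)) I)) y \<partial>lborel)
        = indicator A x * (\<integral>\<^sup>+y. k (\<phi> x) y \<partial>lborel)"
      by (simp add: nn_integral_cmult)
  qed
  also have "\<dots> = (\<integral>\<^sup>+s. ennreal (g s) * (\<integral>\<^sup>+y. k s y \<partial>lborel) \<partial>lborel)"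
    using assms(1) by (auto simp: pushes_to_def)
  finally show ?thesis .
qed

text \<open>Adding an independent coordinate y \<ge> 0 convolves the density with the Heaviside
  function: the sum equals t exactly for s \<le> t and y = t - s, which integrates g up to
  t.\<close>

lemma pushes_to_free:
  assumes p: "pushes_to I A \<phi> g" and I: "finite I" "i \<notin> I"
    and [measurable]: "G \<in> borel_measurable borel"
    and G: "\<And>u. (\<integral>\<^sup>+t. ennreal (g t) * indicator {..u} t \<partial>lborel) = ennreal (G u)"
  shows "pushes_to (insert i I) {x \<in> space (Pi\<^sub>M (insert i I) (\<lambda>_. lborel)). restrict x I \<in> A \<and> 0 \<le> x i}
    (\<lambda>x. \<phi> (restrict x I) + x i) G"
proof -
  note [measurable] = measurable_restrict_subset[OF subset_insertI]
  from p have [measurable]: "A \<in> sets (Pi\<^sub>M I (\<lambda>_. lborel))"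
    "\<phi> \<in> borel_measurable (Pi\<^sub>M I (\<lambda>_. lborel))" "g \<in> borel_measurable borel"
    by (simp_all add: pushes_to_def)
  have "(\<integral>\<^sup>+x. indicator {x \<in> space (Pi\<^sub>M (insert i I) (\<lambda>_. lborel)). restrict x I \<in> A \<and> 0 \<le> x i} x
        * h (\<phi> (restrict x I) + x i) \<partial>Pi\<^sub>M (insert i I) (\<lambda>_. lborel))
      = (\<integral>\<^sup>+t. ennreal (G t) * h t \<partial>lborel)"
    if [measurable]: "h \<in> borel_measurable borel" for h
  proof -
    have "(\<integral>\<^sup>+x. indicator {x \<in> space (Pi\<^sub>M (insert i I) (\<lambda>_. lborel)). restrict x I \<in> A \<and> 0 \<le> x i} x
        * h (\<phi> (restrict x I) + x i) \<partial>Pi\<^sub>M (insert i I) (\<lambda>_. lborel))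
      = (\<integral>\<^sup>+x. indicator A (restrict x I) * (\<lambda>s y. indicator {0..} y * h (s + y)) (\<phi> (restrict x I)) (x i)
        \<partial>Pi\<^sub>M (insert i I) (\<lambda>_. lborel))"
      by (intro nn_integral_cong) (auto simp: indicator_def)
    also have "\<dots> = (\<integral>\<^sup>+s. ennreal (g s) * (\<integral>\<^sup>+y. indicator {0..} y * h (s + y) \<partial>lborel) \<partial>lborel)"
      by (rule pushes_to_insert[OF p I])
        (unfold indicator_def atMost_iff atLeast_iff case_prod_unfold, measurable)
    also have "\<dots> = (\<integral>\<^sup>+s. \<integral>\<^sup>+t. ennreal (g s) * indicator {..t} s * h t \<partial>lborel \<partial>lborel)"
    proof (intro nn_integral_cong)
      fix s :: real
      have "(\<integral>\<^sup>+y. indicator {0..} y * h (s + y) \<partial>lborel) = (\<integral>\<^sup>+t. indicator {0..} (t - s) * h t \<partial>lborel)"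
        \<comment> \<open>The substitution t = s + y, by translation invariance of Lebesgue
          measure.\<close>
        by (subst (2) lborel_distr_plus[of s, symmetric]) (simp add: nn_integral_distr)
      also have "\<dots> = (\<integral>\<^sup>+t. indicator {..t} s * h t \<partial>lborel)"
        by (intro nn_integral_cong) (auto simp: indicator_def)
      finally show "ennreal (g s) * (\<integral>\<^sup>+y. indicator {0..} y * h (s + y) \<partial>lborel)
          = (\<integral>\<^sup>+t. ennreal (g s) * indicator {..t} s * h t \<partial>lborel)"
        by (simp add: nn_integral_cmult mult.assoc indicator_def)
    qed
    also have "\<dots> = (\<integral>\<^sup>+t. \<integral>\<^sup>+s. ennreal (g s) * indicator {..t} s * h t \<partial>lborel \<partial>lborel)"
      by (rule lborel_pair.Fubini')
        (unfold borel_measurable_lborel_pair indicator_def atMost_iff case_prod_unfold, measurable)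
    also have "\<dots> = (\<integral>\<^sup>+t. ennreal (G t) * h t \<partial>lborel)"
      by (simp add: nn_integral_multc G)
    finally show ?thesis .
  qed
  then show ?thesis unfolding pushes_to_def by auto measurable
qed

text \<open>The new coordinate closes the block and becomes the running sum of the next one. When it
  has the value t \<ge> 0, the old sum s ranges over s \<le> c - t, a set of mass G (c - t).\<close>

lemma pushes_to_cap:
  assumes p: "pushes_to I A \<phi> g" and I: "finite I" "i \<notin> I"
    and [measurable]: "G \<in> borel_measurable borel"
    and G: "\<And>u. (\<integral>\<^sup>+t. ennreal (g t) * indicator {..u} t \<partial>lborel) = ennreal (G u)"
  shows "pushes_to (insert i I)
    {x \<in> space (Pi\<^sub>M (insert i I) (\<lambda>_. lborel)). restrict x I \<in> A \<and> 0 \<le> x i \<and> \<phi> (restrict x I) + x i \<le> c}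
    (\<lambda>x. x i) (\<lambda>t. if t < 0 then 0 else G (c - t))"
proof -
  note [measurable] = measurable_restrict_subset[OF subset_insertI]
  from p have [measurable]: "A \<in> sets (Pi\<^sub>M I (\<lambda>_. lborel))"
    "\<phi> \<in> borel_measurable (Pi\<^sub>M I (\<lambda>_. lborel))" "g \<in> borel_measurable borel"
    by (simp_all add: pushes_to_def)
  let ?B = "{x \<in> space (Pi\<^sub>M (insert i I) (\<lambda>_. lborel)). restrict x I \<in> A \<and> 0 \<le> x i \<and> \<phi> (restrict x I) + x i \<le> c}"
  have "(\<integral>\<^sup>+x. indicator ?B x * h (x i) \<partial>Pi\<^sub>M (insert i I) (\<lambda>_. lborel))
      = (\<integral>\<^sup>+t. ennreal (if t < 0 then 0 else G (c - t)) * h t \<partial>lborel)"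
    if [measurable]: "h \<in> borel_measurable borel" for h
  proof -
    have "(\<integral>\<^sup>+x. indicator ?B x * h (x i) \<partial>Pi\<^sub>M (insert i I) (\<lambda>_. lborel))
      = (\<integral>\<^sup>+x. indicator A (restrict x I) * (\<lambda>s y. indicator {..c - y} s * (indicator {0..} y * h y)) (\<phi> (restrict x I)) (x i)
        \<partial>Pi\<^sub>M (insert i I) (\<lambda>_. lborel))"
      by (intro nn_integral_cong) (auto simp: indicator_def)
    also have "\<dots> = (\<integral>\<^sup>+s. ennreal (g s) * (\<integral>\<^sup>+y. indicator {..c - y} s * (indicator {0..} y * h y) \<partial>lborel) \<partial>lborel)"
      by (rule pushes_to_insert[OF p I])
        (unfold indicator_def atMost_iff atLeast_iff case_prod_unfold, measurable)
    also have "\<dots> = (\<integral>\<^sup>+s. \<integral>\<^sup>+t. ennreal (g s) * indicator {..c - t} s * (indicator {0..} t * h t) \<partial>lborel \<partial>lborel)"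
      unfolding mult.assoc
      by (intro nn_integral_cong nn_integral_cmult[symmetric])
        (unfold indicator_def atMost_iff atLeast_iff, measurable)
    also have "\<dots> = (\<integral>\<^sup>+t. \<integral>\<^sup>+s. ennreal (g s) * indicator {..c - t} s * (indicator {0..} t * h t) \<partial>lborel \<partial>lborel)"
      by (rule lborel_pair.Fubini')
        (unfold borel_measurable_lborel_pair indicator_def atMost_iff case_prod_unfold, measurable)
    also have "\<dots> = (\<integral>\<^sup>+t. ennreal (G (c - t)) * (indicator {0..} t * h t) \<partial>lborel)"
      by (simp add: nn_integral_multc G)
    also have "\<dots> = (\<integral>\<^sup>+t. ennreal (if t < 0 then 0 else G (c - t)) * h t \<partial>lborel)"
      by (intro nn_integral_cong) (auto simp: indicator_def)
    finally show ?thesis .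
  qed
  then show ?thesis unfolding pushes_to_def by auto measurable
qed

section \<open>The polytope built up block by block\<close>

text \<open>\<open>Z_polytope\<close> with the block sizes \<delta> as parameter in place of
  \<open>S\<close>, so that an induction can append a block.\<close>

definition chain_polytope :: "nat list \<Rightarrow> (nat \<Rightarrow> real) \<Rightarrow> (nat \<Rightarrow> real) set" where
  "chain_polytope \<delta> d =
     {x \<in> {1..1 + sum_list \<delta>} \<rightarrow>\<^sub>E UNIV.
        (\<forall>j\<in>{1..1 + sum_list \<delta>}. 0 \<le> x j) \<and> x 1 \<le> d 1 \<and>
        (\<forall>i\<in>{1..length \<delta>}.
           (\<Sum>j = sum_list (take (i - 1) \<delta>) + 1..sum_list (take i \<delta>) + 1. x j) \<le> d (i + 1))}"

text \<open>The intermediate stage: the blocks of \<delta> are closed, and r coordinates of the next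
  block have been added, not yet subject to an upper bound.\<close>

definition chain_prefix :: "nat list \<Rightarrow> (nat \<Rightarrow> real) \<Rightarrow> nat \<Rightarrow> (nat \<Rightarrow> real) set" where
  "chain_prefix \<delta> d r =
     {x \<in> {1..1 + sum_list \<delta> + r} \<rightarrow>\<^sub>E UNIV. restrict x {1..1 + sum_list \<delta>} \<in> chain_polytope \<delta> d \<and>
        (\<forall>j\<in>{2 + sum_list \<delta>..1 + sum_list \<delta> + r}. 0 \<le> x j)}"

lemma sum_list_take_le: "sum_list (take i xs) \<le> sum_list (xs :: nat list)"
  by (metis append_take_drop_id le_add1 sum_list_append)

text \<open>A new block of size \<open>Suc q\<close> adds q free coordinates and a closing one, of
  index \<open>2 + sum_list \<delta> + q\<close>; its sum starts at the shared coordinate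
  \<open>1 + sum_list \<delta>\<close>. The right-hand side is written in the shape that
  \<open>pushes_to_cap\<close> produces.\<close>

lemma chain_polytope_snoc:
  "chain_polytope (\<delta> @ [Suc q]) d =
    {x \<in> {1..2 + sum_list \<delta> + q} \<rightarrow>\<^sub>E UNIV. restrict x {1..1 + sum_list \<delta> + q} \<in> chain_prefix \<delta> d q \<and>
      0 \<le> x (2 + sum_list \<delta> + q) \<and>
      (\<Sum>j = 1 + sum_list \<delta>..1 + sum_list \<delta> + q. restrict x {1..1 + sum_list \<delta> + q} j) + x (2 + sum_list \<delta> + q) \<le> d (length \<delta> + 2)}"
    (is "_ = ?R")
proof -
  let ?s = "sum_list \<delta>"
  have rr: "restrict (restrict x {1..1 + ?s + q}) {1..1 + ?s} = restrict x {1..1 + ?s}" for x :: "nat \<Rightarrow> real"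
    by (auto simp: fun_eq_iff)
  have sums: "(\<Sum>j = sum_list (take (i - 1) \<delta>) + 1..sum_list (take i \<delta>) + 1. restrict x {1..1 + ?s} j)
      = (\<Sum>j = sum_list (take (i - 1) \<delta>) + 1..sum_list (take i \<delta>) + 1. x j)" for x :: "nat \<Rightarrow> real" and i
    using sum_list_take_le[of i \<delta>] by (intro sum.cong) auto
  have last: "(\<Sum>j = 1 + ?s..1 + ?s + q. restrict x {1..1 + ?s + q} j) + x (2 + ?s + q)
      = (\<Sum>j = ?s + 1..?s + Suc q + 1. x j)" for x :: "nat \<Rightarrow> real"
  proof -
    have "(\<Sum>j = 1 + ?s..1 + ?s + q. restrict x {1..1 + ?s + q} j) = (\<Sum>j = 1 + ?s..1 + ?s + q. x j)"
      by (intro sum.cong) auto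
    then show ?thesis by simp
  qed
  have nonneg: "(\<forall>j\<in>{1..2 + ?s + q}. 0 \<le> x j) \<longleftrightarrow>
     (\<forall>j\<in>{1..1 + ?s}. 0 \<le> x j) \<and> (\<forall>j\<in>{2 + ?s..1 + ?s + q}. 0 \<le> x j) \<and> 0 \<le> x (2 + ?s + q)" for x :: "nat \<Rightarrow> real"
  proof -
    have "{1..2 + ?s + q} = {1..1 + ?s} \<union> {2 + ?s..1 + ?s + q} \<union> {2 + ?s + q}" by auto
    then show ?thesis by (simp only: ball_Un) auto
  qed
  have caps: "(\<forall>i\<in>{1..length (\<delta> @ [Suc q])}.
       (\<Sum>j = sum_list (take (i - 1) (\<delta> @ [Suc q])) + 1..sum_list (take i (\<delta> @ [Suc q])) + 1. x j) \<le> d (i + 1)) \<longleftrightarrow>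
     (\<forall>i\<in>{1..length \<delta>}. (\<Sum>j = sum_list (take (i - 1) \<delta>) + 1..sum_list (take i \<delta>) + 1. x j) \<le> d (i + 1)) \<and>
     (\<Sum>j = ?s + 1..?s + Suc q + 1. x j) \<le> d (length \<delta> + 2)" for x :: "nat \<Rightarrow> real"
  proof -
    have "{1..length (\<delta> @ [Suc q])} = insert (Suc (length \<delta>)) {1..length \<delta>}" by auto
    then show ?thesis by (simp add: conj_commute)
  qed
  have ext: "restrict x B \<in> B \<rightarrow>\<^sub>E UNIV" for x :: "nat \<Rightarrow> real" and B
    by auto
  have res: "(\<forall>j\<in>{1..1 + ?s}. 0 \<le> restrict x {1..1 + ?s} j) \<longleftrightarrow> (\<forall>j\<in>{1..1 + ?s}. 0 \<le> x j)"
    "(\<forall>j\<in>{2 + ?s..1 + ?s + q}. 0 \<le> restrict x {1..1 + ?s + q} j) \<longleftrightarrow> (\<forall>j\<in>{2 + ?s..1 + ?s + q}. 0 \<le> x j)"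
    "restrict x {1..1 + ?s} 1 = x 1" for x :: "nat \<Rightarrow> real"
    by auto
  have len: "1 + sum_list (\<delta> @ [Suc q]) = 2 + ?s + q"
    by simp
  have pre: "restrict x {1..1 + ?s + q} \<in> chain_prefix \<delta> d q \<longleftrightarrow>
      ((\<forall>j\<in>{1..1 + ?s}. 0 \<le> x j) \<and> x 1 \<le> d 1 \<and>
       (\<forall>i\<in>{1..length \<delta>}. (\<Sum>j = sum_list (take (i - 1) \<delta>) + 1..sum_list (take i \<delta>) + 1. x j) \<le> d (i + 1))) \<and>
      (\<forall>j\<in>{2 + ?s..1 + ?s + q}. 0 \<le> x j)" for x
    unfolding chain_prefix_def mem_Collect_eq rr unfolding chain_polytope_def[of \<delta>]
    by (simp only: mem_Collect_eq sums ext res simp_thms)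
  show ?thesis
    by (simp only: chain_polytope_def[of "\<delta> @ [Suc q]"] nonneg caps last len pre conj_ac)
qed

text \<open>At r = 0 the sum of the new block is the shared coordinate alone; every further
  coordinate is an instance of \<open>pushes_to_free\<close>.\<close>

lemma pushes_to_chain_prefix:
  assumes p: "pushes_to {1..1 + sum_list \<delta>} (chain_polytope \<delta> d) (\<lambda>x. x (1 + sum_list \<delta>)) (run_density d gs 0)"
    and gs: "gs \<noteq> []" "\<forall>g\<in>set gs. g \<ge> 1"
  shows "pushes_to {1..1 + sum_list \<delta> + r} (chain_prefix \<delta> d r)
    (\<lambda>x. \<Sum>j = 1 + sum_list \<delta>..1 + sum_list \<delta> + r. x j) (run_density d gs r)"
proof (induction r)
  case 0
  have "chain_prefix \<delta> d 0 = chain_polytope \<delta> d"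
  proof -
    have "restrict x {1..1 + sum_list \<delta>} = x" if "x \<in> {1..1 + sum_list \<delta>} \<rightarrow>\<^sub>E UNIV" for x :: "nat \<Rightarrow> real"
      using that by (auto simp: PiE_restrict)
    then show ?thesis by (auto simp: chain_prefix_def chain_polytope_def simp del: restrict_apply)
  qed
  then show ?case using p by simp
next
  case (Suc r)
  let ?s = "sum_list \<delta>"
  let ?I = "{1..1 + ?s + r}" and ?i = "2 + ?s + r"
  have I: "insert ?i ?I = {1..1 + ?s + Suc r}" by auto
  have rr: "restrict (restrict x ?I) {1..1 + ?s} = restrict x {1..1 + ?s}" for x :: "nat \<Rightarrow> real"
    by (auto simp: fun_eq_iff)
  have ext: "restrict x B \<in> B \<rightarrow>\<^sub>E UNIV" for x :: "nat \<Rightarrow> real" and B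
    by auto
  have nonneg: "(\<forall>j\<in>{2 + ?s..1 + ?s + Suc r}. 0 \<le> x j) \<longleftrightarrow>
      (\<forall>j\<in>{2 + ?s..1 + ?s + r}. 0 \<le> restrict x ?I j) \<and> 0 \<le> x ?i" for x :: "nat \<Rightarrow> real"
  proof -
    have "{2 + ?s..1 + ?s + Suc r} = insert ?i {2 + ?s..1 + ?s + r}" by auto
    then show ?thesis by auto
  qed
  have A: "{x \<in> space (Pi\<^sub>M (insert ?i ?I) (\<lambda>_. lborel)). restrict x ?I \<in> chain_prefix \<delta> d r \<and> 0 \<le> x ?i}
      = chain_prefix \<delta> d (Suc r)"
  proof -
    have "space (Pi\<^sub>M (insert ?i ?I) (\<lambda>_. lborel :: real measure)) = {1..1 + ?s + Suc r} \<rightarrow>\<^sub>E UNIV"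
      by (simp only: I space_PiM space_lborel space_borel)
    moreover have "restrict x ?I \<in> chain_prefix \<delta> d r \<longleftrightarrow> restrict x {1..1 + ?s} \<in> chain_polytope \<delta> d \<and>
        (\<forall>j\<in>{2 + ?s..1 + ?s + r}. 0 \<le> restrict x ?I j)" for x
      by (simp only: chain_prefix_def mem_Collect_eq rr ext simp_thms)
    ultimately show ?thesis
      by (simp only: chain_prefix_def[of \<delta> d "Suc r"] nonneg conj_assoc)
  qed
  have sum: "(\<Sum>j = 1 + ?s..1 + ?s + r. restrict x ?I j) + x ?i = (\<Sum>j = 1 + ?s..1 + ?s + Suc r. x j)"
    for x :: "nat \<Rightarrow> real"
  proof -
    have "(\<Sum>j = 1 + ?s..1 + ?s + r. restrict x ?I j) = (\<Sum>j = 1 + ?s..1 + ?s + r. x j)"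
      by (intro sum.cong) auto
    then show ?thesis by simp
  qed
  have "pushes_to (insert ?i ?I)
     {x \<in> space (Pi\<^sub>M (insert ?i ?I) (\<lambda>_. lborel)). restrict x ?I \<in> chain_prefix \<delta> d r \<and> 0 \<le> x ?i}
    (\<lambda>x. (\<Sum>j = 1 + ?s..1 + ?s + r. restrict x ?I j) + x ?i) (run_density d gs (Suc r))"
    by (rule pushes_to_free[OF Suc]) (use gs nn_integral_run_density[of gs r d] in auto)
  then show ?case unfolding A sum unfolding I .
qed

text \<open>Blocks are appended at the end, matching the reversed list in
  \<open>run_density\<close>. The base case is a single coordinate on [0, d 1], whose density is the
  indicator of that interval.\<close>

lemma pushes_to_chain_polytope:
  assumes "\<forall>g\<in>set \<delta>. g \<ge> 1"
  shows "pushes_to {1..1 + sum_list \<delta>} (chain_polytope \<delta> d) (\<lambda>x. x (1 + sum_list \<delta>))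
    (run_density d (rev (1 # \<delta>)) 0)"
  using assms
proof (induction \<delta> rule: rev_induct)
  case Nil
  interpret product_sigma_finite "\<lambda>_::nat. lborel :: real measure" ..
  have A: "chain_polytope [] d = {x \<in> space (Pi\<^sub>M {1::nat} (\<lambda>_. lborel)). 0 \<le> x 1 \<and> x 1 \<le> d 1}"
    by (auto simp: chain_polytope_def space_PiM)
  have int: "(\<integral>\<^sup>+x. indicator (chain_polytope [] d) x * h (x 1) \<partial>Pi\<^sub>M {1::nat} (\<lambda>_. lborel))
      = (\<integral>\<^sup>+t. ennreal (run_density d (rev [1]) 0 t) * h t \<partial>lborel)"
    if [measurable]: "h \<in> borel_measurable borel" for h :: "real \<Rightarrow> ennreal"
  proof -
    have "(\<integral>\<^sup>+x. indicator (chain_polytope [] d) x * h (x 1) \<partial>Pi\<^sub>M {1::nat} (\<lambda>_. lborel))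
      = (\<integral>\<^sup>+x. (\<lambda>t. indicator {0..d 1} t * h t) (x 1) \<partial>Pi\<^sub>M {1::nat} (\<lambda>_. lborel))"
      by (intro nn_integral_cong) (auto simp: A indicator_def)
    also have "\<dots> = (\<integral>\<^sup>+t. indicator {0..d 1} t * h t \<partial>lborel)"
      by (rule product_nn_integral_singleton) measurable
    also have "\<dots> = (\<integral>\<^sup>+t. ennreal (run_density d (rev [1]) 0 t) * h t \<partial>lborel)"
      by (intro nn_integral_cong) (auto simp: indicator_def run_density.simps)
    finally show ?thesis .
  qed
  have "chain_polytope [] d \<in> sets (Pi\<^sub>M {1::nat} (\<lambda>_. lborel))"
    unfolding A by measurable
  moreover have "(\<lambda>x. x 1) \<in> borel_measurable (Pi\<^sub>M {1} (\<lambda>_. lborel :: real measure))"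
    by measurable
  ultimately show ?case
    using int by (simp add: pushes_to_def)
next
  case (snoc g \<delta>)
  \<comment> \<open>The block splits into q free coordinates and one that closes it.\<close>
  then obtain q where g: "g = Suc q" by (cases g) auto
  let ?s = "sum_list \<delta>"
  let ?I = "{1..1 + ?s + q}" and ?i = "2 + ?s + q"
  let ?gs = "rev (1 # \<delta>)"
  have gs: "\<forall>g\<in>set ?gs. g \<ge> 1" using snoc.prems by auto
  have I: "insert ?i ?I = {1..2 + ?s + q}" by auto
  have pre: "pushes_to ?I (chain_prefix \<delta> d q) (\<lambda>x. \<Sum>j = 1 + ?s..1 + ?s + q. x j) (run_density d ?gs q)"
    by (rule pushes_to_chain_prefix) (use snoc gs in auto)
  have A: "{x \<in> space (Pi\<^sub>M (insert ?i ?I) (\<lambda>_. lborel)). restrict x ?I \<in> chain_prefix \<delta> d q \<and> 0 \<le> x ?i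
      \<and> (\<Sum>j = 1 + ?s..1 + ?s + q. restrict x ?I j) + x ?i \<le> d (length \<delta> + 2)} = chain_polytope (\<delta> @ [g]) d"
    by (simp only: g chain_polytope_snoc I space_PiM space_lborel space_borel)
  have G: "(\<lambda>t. if t < 0 then 0 else run_density d ?gs (Suc q) (d (length \<delta> + 2) - t))
      = run_density d (rev (1 # \<delta> @ [g])) 0"
    by (auto simp: fun_eq_iff g run_density_Cons_0)
  have "pushes_to (insert ?i ?I)
     {x \<in> space (Pi\<^sub>M (insert ?i ?I) (\<lambda>_. lborel)). restrict x ?I \<in> chain_prefix \<delta> d q \<and> 0 \<le> x ?i
      \<and> (\<Sum>j = 1 + ?s..1 + ?s + q. restrict x ?I j) + x ?i \<le> d (length \<delta> + 2)}
    (\<lambda>x. x ?i) (\<lambda>t. if t < 0 then 0 else run_density d ?gs (Suc q) (d (length \<delta> + 2) - t))"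
    by (rule pushes_to_cap[OF pre]) (use gs nn_integral_run_density[of ?gs q d] in auto)
  then have "pushes_to {1..2 + ?s + q} (chain_polytope (\<delta> @ [g]) d) (\<lambda>x. x ?i) (run_density d (rev (1 # \<delta> @ [g])) 0)"
    unfolding A G unfolding I .
  moreover have "1 + sum_list (\<delta> @ [g]) = 2 + ?s + q"
    by (simp add: g)
  ultimately show ?case by (simp only:)
qed

text \<open>The volume is the total mass of the density of the last coordinate. This density
  vanishes above the last bound, so integrating up to that bound loses nothing and yields one more
  antiderivative.\<close>

lemma measure_chain_polytope:
  assumes "\<forall>g\<in>set \<delta>. g \<ge> 1" and "d (length \<delta> + 1) \<ge> 0"
  shows "measure (Pi\<^sub>M {1..1 + sum_list \<delta>} (\<lambda>_. lborel)) (chain_polytope \<delta> d)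
    = run_density d (rev (1 # \<delta>)) 1 (d (length \<delta> + 1))"
proof -
  let ?M = "Pi\<^sub>M {1..1 + sum_list \<delta>} (\<lambda>_. lborel :: real measure)"
  let ?gs = "rev (1 # \<delta>)" and ?c = "d (length \<delta> + 1)"
  have p: "pushes_to {1..1 + sum_list \<delta>} (chain_polytope \<delta> d) (\<lambda>x. x (1 + sum_list \<delta>)) (run_density d ?gs 0)"
    by (rule pushes_to_chain_polytope) fact
  have gs: "\<forall>g\<in>set ?gs. g \<ge> 1" using assms by auto
  obtain g hs where ghs: "?gs = g # hs" by (cases ?gs) auto
  then have len: "length (g # hs) = length \<delta> + 1" by (metis length_rev length_Cons Suc_eq_plus1)
  have "emeasure ?M (chain_polytope \<delta> d) = (\<integral>\<^sup>+x. indicator (chain_polytope \<delta> d) x \<partial>?M)"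
    using p by (subst nn_integral_indicator) (auto simp: pushes_to_def)
  also have "\<dots> = (\<integral>\<^sup>+t. ennreal (run_density d ?gs 0 t) \<partial>lborel)"
  proof -
    have "\<forall>h \<in> borel_measurable borel. (\<integral>\<^sup>+x. indicator (chain_polytope \<delta> d) x * h (x (1 + sum_list \<delta>)) \<partial>?M)
        = (\<integral>\<^sup>+t. ennreal (run_density d ?gs 0 t) * h t \<partial>lborel)"
      using p unfolding pushes_to_def by (elim conjE)
    from bspec[OF this, of "\<lambda>_. 1"]
    show ?thesis by simp
  qed
  also have "\<dots> = (\<integral>\<^sup>+t. ennreal (run_density d ?gs 0 t) * indicator {..?c} t \<partial>lborel)"
  proof (rule nn_integral_cong)
    fix t
    show "ennreal (run_density d ?gs 0 t) = ennreal (run_density d ?gs 0 t) * indicator {..?c} t"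
      using run_density_Cons_0_beyond[of d g hs t] unfolding ghs len by (auto simp: indicator_def)
  qed
  also have "\<dots> = ennreal (run_density d ?gs 1 ?c)"
    using nn_integral_run_density[of ?gs 0 d ?c] gs by simp
  finally show ?thesis
    using run_density_nonneg[OF gs] by (simp add: measure_def)
qed

subsection \<open>Unrolling the recursion over \<open>K\<^sub>\<gamma>\<close>\<close>

text \<open>Positions count from 1. One function serves both signs: on \<alpha> it gives the
  exponent of the summand, on \<open>1 # \<delta>\<close> the exponent of the global sign.\<close>

definition odd_sum :: "nat list \<Rightarrow> nat" where
  "odd_sum xs = (\<Sum>j | j \<in> {1..length xs} \<and> odd j. xs ! (j - 1))"

lemma odd_sum_Nil [simp]: "odd_sum [] = 0"
  by (simp add: odd_sum_def)

lemma odd_sum_snoc: "odd_sum (xs @ [x]) = odd_sum xs + (if even (length xs) then x else 0)"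
proof -
  let ?J = "\<lambda>n. {j. j \<in> {1..n} \<and> odd j}"
  have split: "?J (Suc (length xs)) = ?J (length xs) \<union> (if even (length xs) then {Suc (length xs)} else {})"
    by (auto simp: le_Suc_eq)
  have "(\<Sum>j \<in> ?J (length xs). (xs @ [x]) ! (j - 1)) = odd_sum xs"
    unfolding odd_sum_def by (intro sum.cong) (auto simp: nth_append)
  moreover have "(\<Sum>j \<in> ?J (Suc (length xs)). (xs @ [x]) ! (j - 1))
      = (\<Sum>j \<in> ?J (length xs). (xs @ [x]) ! (j - 1)) + (if even (length xs) then x else 0)"
    unfolding split by (subst sum.union_disjoint) auto
  ultimately show ?thesis by (simp add: odd_sum_def)
qed

lemma prod_nth_snoc:
  "(\<Prod>j = 1..length (xs @ [x]). f j ((xs @ [x]) ! (j - 1)))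
     = (\<Prod>j = 1..length xs. f j (xs ! (j - 1))) * (f (Suc (length xs)) x :: 'a :: comm_monoid_mult)"
proof -
  have "(\<Prod>j = 1..length xs. f j ((xs @ [x]) ! (j - 1))) = (\<Prod>j = 1..length xs. f j (xs ! (j - 1)))"
    by (intro prod.cong) (auto simp: nth_append)
  then show ?thesis by simp
qed

lemma K_set_singleton: "K_set [R] = {[R]}"
proof -
  have "\<alpha> = [R]" if "length \<alpha> = 1" "sum_list \<alpha> = R" for \<alpha>
    using that by (auto simp: length_Suc_conv)
  then show ?thesis by (auto simp: K_set_def)
qed

text \<open>The inequality for the full length follows from the equality of the totals.\<close>

lemma K_set_snoc_iff:
  "\<alpha> \<in> K_set (\<gamma> @ [R]) \<longleftrightarrow> length \<alpha> = Suc (length \<gamma>) \<and> sum_list \<alpha> = sum_list \<gamma> + R \<and>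
    (\<forall>i\<in>{1..length \<gamma>}. sum_list (take i \<gamma>) \<le> sum_list (take i \<alpha>))"
proof -
  have "{1..length (\<gamma> @ [R])} = insert (Suc (length \<gamma>)) {1..length \<gamma>}" by auto
  then show ?thesis by (auto simp: K_set_def)
qed

text \<open>Remove the last entry e. Given the total, the inequality up to the part g says e \<le>
  R, and the surplus R - e is carried over to g. This is the index shift in the recursion for
  \<open>run_density\<close>.\<close>

lemma K_set_snoc_snoc:
  "K_set (\<gamma> @ [g, R]) = (\<Union>e\<le>R. (\<lambda>\<alpha>. \<alpha> @ [e]) ` K_set (\<gamma> @ [g + (R - e)]))"
proof -
  have mem: "\<alpha> @ [e] \<in> K_set ((\<gamma> @ [g]) @ [R]) \<longleftrightarrow> e \<le> R \<and> \<alpha> \<in> K_set (\<gamma> @ [g + (R - e)])" for \<alpha> e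
  proof -
    have "{1..length (\<gamma> @ [g])} = insert (Suc (length \<gamma>)) {1..length \<gamma>}" by auto
    then show ?thesis unfolding K_set_snoc_iff by auto
  qed
  have "\<exists>\<beta> e. \<alpha> = \<beta> @ [e]" if "\<alpha> \<in> K_set ((\<gamma> @ [g]) @ [R])" for \<alpha>
    using that unfolding K_set_snoc_iff by (cases \<alpha> rule: rev_cases) auto
  note snoc = this
  have eq: "(\<gamma> @ [g]) @ [R] = \<gamma> @ [g, R]" by simp
  note mem = mem[unfolded eq] and snoc = snoc[unfolded eq]
  show ?thesis
  proof (intro equalityI subsetI)
    fix \<alpha> assume \<alpha>: "\<alpha> \<in> K_set (\<gamma> @ [g, R])"
    with snoc obtain \<beta> e where "\<alpha> = \<beta> @ [e]" by blast
    moreover from this \<alpha> have "e \<le> R \<and> \<beta> \<in> K_set (\<gamma> @ [g + (R - e)])"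
      using mem by (simp only:)
    ultimately show "\<alpha> \<in> (\<Union>e\<le>R. (\<lambda>\<alpha>. \<alpha> @ [e]) ` K_set (\<gamma> @ [g + (R - e)]))" by blast
  next
    fix \<alpha> assume "\<alpha> \<in> (\<Union>e\<le>R. (\<lambda>\<alpha>. \<alpha> @ [e]) ` K_set (\<gamma> @ [g + (R - e)]))"
    then obtain e \<beta> where "e \<le> R" "\<beta> \<in> K_set (\<gamma> @ [g + (R - e)])" "\<alpha> = \<beta> @ [e]" by blast
    then show "\<alpha> \<in> K_set (\<gamma> @ [g, R])" by (simp only: mem)
  qed
qed

lemma sum_K_set_snoc_snoc:
  "(\<Sum>\<alpha>\<in>K_set (\<gamma> @ [g, R]). f \<alpha>) = (\<Sum>e\<le>R. \<Sum>\<alpha>\<in>K_set (\<gamma> @ [g + (R - e)]). (f (\<alpha> @ [e]) :: 'a :: comm_monoid_add))"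
proof -
  have "(\<Sum>\<alpha>\<in>K_set (\<gamma> @ [g, R]). f \<alpha>) = (\<Sum>e\<le>R. sum f ((\<lambda>\<alpha>. \<alpha> @ [e]) ` K_set (\<gamma> @ [g + (R - e)])))"
    unfolding K_set_snoc_snoc by (rule sum.UNION_disjoint) (auto simp: finite_K_set)
  also have "\<dots> = (\<Sum>e\<le>R. \<Sum>\<alpha>\<in>K_set (\<gamma> @ [g + (R - e)]). f (\<alpha> @ [e]))"
    by (rule sum.cong[OF refl], subst sum.reindex) (auto simp: inj_on_def)
  finally show ?thesis .
qed

text \<open>Each unrolling of \<open>run_density_beyond\<close> chooses the exponent e of the last
  bound and hands R - e integrations to the previous block, just as \<open>K_set_snoc_snoc\<close>
  strips the last entry of \<alpha>. The factorials are those of the multinomial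
  coefficient.\<close>

lemma run_density_eq_sum_K_set:
  assumes "\<forall>g\<in>set gs. g \<ge> 1" and "0 \<le> d 1" and "\<forall>i\<in>{1..length gs}. d i \<le> d (i + 1)"
  shows "run_density d gs (Suc R) (d (length gs + 1)) =
    (\<Sum>\<alpha>\<in>K_set (rev gs @ [R]). (- 1) ^ (odd_sum (rev gs @ [R]) + odd_sum \<alpha>) *
       (\<Prod>j = 1..length \<alpha>. d j ^ (\<alpha> ! (j - 1)) / fact (\<alpha> ! (j - 1))))"
  using assms
proof (induction gs arbitrary: R)
  case Nil
  then show ?case
    using odd_sum_snoc[of "[]" R] by (simp add: K_set_singleton run_density.simps flip: mult_2)
next
  case (Cons g gs)
  let ?m = "length gs" and ?t = "d (length gs + 2)"
  let ?w = "\<lambda>\<alpha>. \<Prod>j = 1..length \<alpha>. d j ^ (\<alpha> ! (j - 1)) / fact (\<alpha> ! (j - 1))"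
  let ?s = "\<lambda>e \<alpha>. (- 1 :: real) ^ (odd_sum (rev gs @ [g + (R - e)]) + odd_sum \<alpha>)"
  have dpos: "0 \<le> d (i + 1)" if "i \<le> Suc ?m" for i
    using that
  proof (induction i)
    case (Suc i)
    then show ?case using Cons.prems(3)[rule_format, of "i + 1"] by auto
  qed (use Cons.prems in simp)
  have IH: "run_density d gs (Suc Q) (d (?m + 1)) = (\<Sum>\<alpha>\<in>K_set (rev gs @ [Q]).
      (- 1) ^ (odd_sum (rev gs @ [Q]) + odd_sum \<alpha>) * ?w \<alpha>)" for Q
    using Cons by simp
  \<comment> \<open>Monotonicity of d enters here: \<open>?t\<close> is at least the bound of the
    last closed block, so no reflected term occurs.\<close>
  have "run_density d (g # gs) (Suc R) ?t
    = (\<Sum>j<Suc R. (- 1) ^ j * run_density d gs (g + 1 + j) (d (length (g # gs))) * (?t ^ (R - j) / fact (R - j)))"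
    by (rule run_density_beyond) (use Cons.prems dpos[of "Suc ?m"] in auto)
  \<comment> \<open>The order is reversed by e = R - j, so that the index is the exponent of
    \<open>?t\<close>.\<close>
  also have "\<dots> = (\<Sum>e<Suc R. (- 1) ^ (R - e) * run_density d gs (g + 1 + (R - e)) (d (length (g # gs))) *
      (?t ^ e / fact e))"
    by (subst sum.nat_diff_reindex[symmetric]) (auto intro!: sum.cong)
  also have "\<dots> = (\<Sum>e\<le>R. (- 1) ^ (R - e) * run_density d gs (Suc (g + (R - e))) (d (?m + 1)) * (?t ^ e / fact e))"
    by (intro sum.cong) auto
  also have "\<dots> = (\<Sum>e\<le>R. \<Sum>\<alpha>\<in>K_set (rev gs @ [g + (R - e)]).
       (- 1) ^ (R - e) * ?s e \<alpha> * (?w \<alpha> * (?t ^ e / fact e)))"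
    unfolding IH by (simp add: sum_distrib_left sum_distrib_right mult_ac)
  also have "\<dots> = (\<Sum>e\<le>R. \<Sum>\<alpha>\<in>K_set (rev gs @ [g + (R - e)]).
       (- 1) ^ (odd_sum (rev gs @ [g, R]) + odd_sum (\<alpha> @ [e])) * ?w (\<alpha> @ [e]))"
  proof (intro sum.cong refl)
    fix e \<alpha> assume e: "e \<in> {..R}" and "\<alpha> \<in> K_set (rev gs @ [g + (R - e)])"
    then have len: "length \<alpha> = Suc ?m" by (simp add: K_set_snoc_iff)
    have "?w (\<alpha> @ [e]) = ?w \<alpha> * (?t ^ e / fact e)"
      by (subst prod_nth_snoc) (simp add: len)
    moreover have "(- 1 :: real) ^ (odd_sum (rev gs @ [g, R]) + odd_sum (\<alpha> @ [e])) = (- 1) ^ (R - e) * ?s e \<alpha>"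
    proof -
      \<comment> \<open>If the length of \<open>gs\<close> is even, the surplus R - e occurs twice
        on the right; if it is odd, R + e on the left has the parity of R - e.\<close>
      have "even (odd_sum (rev gs @ [g, R]) + odd_sum (\<alpha> @ [e])) \<longleftrightarrow>
          even ((R - e) + (odd_sum (rev gs @ [g + (R - e)]) + odd_sum \<alpha>))"
        using odd_sum_snoc[of "rev gs @ [g]" R] e by (auto simp: odd_sum_snoc len)
      then have "(- 1 :: real) ^ (odd_sum (rev gs @ [g, R]) + odd_sum (\<alpha> @ [e]))
          = (- 1) ^ ((R - e) + (odd_sum (rev gs @ [g + (R - e)]) + odd_sum \<alpha>))"
        unfolding minus_one_power_iff by simp
      then show ?thesis by (simp only: power_add)
    qed
    ultimately show "(- 1) ^ (R - e) * ?s e \<alpha> * (?w \<alpha> * (?t ^ e / fact e))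
       = (- 1) ^ (odd_sum (rev gs @ [g, R]) + odd_sum (\<alpha> @ [e])) * ?w (\<alpha> @ [e])"
      by simp
  qed
  also have "\<dots> = (\<Sum>\<alpha>\<in>K_set (rev gs @ [g, R]). (- 1) ^ (odd_sum (rev gs @ [g, R]) + odd_sum \<alpha>) * ?w \<alpha>)"
    by (rule sum_K_set_snoc_snoc[symmetric])
  finally show ?case by simp
qed

subsection \<open>Parking functions by content\<close>

lemma a_vec_Nil [simp]: "a_vec [] = []"
  by (simp add: a_vec_def)

lemma a_vec_snoc: "a_vec (\<gamma> @ [x]) = a_vec \<gamma> @ replicate x (Suc (length \<gamma>))"
proof -
  have "map (\<lambda>i. replicate ((\<gamma> @ [x]) ! (i - 1)) i) [1..<length \<gamma> + 1]
      = map (\<lambda>i. replicate (\<gamma> ! (i - 1)) i) [1..<length \<gamma> + 1]"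
    by (intro map_cong) (auto simp: nth_append)
  moreover have "[1..<length (\<gamma> @ [x]) + 1] = [1..<length \<gamma> + 1] @ [Suc (length \<gamma>)]"
    by simp
  ultimately show ?thesis by (simp only: a_vec_def map_append concat_append) simp
qed

lemma length_a_vec [simp]: "length (a_vec \<gamma>) = sum_list \<gamma>"
  by (induction \<gamma> rule: rev_induct) (simp_all add: a_vec_snoc)

lemma set_a_vec: "set (a_vec \<gamma>) \<subseteq> {1..length \<gamma>}"
  by (auto simp: a_vec_def)

lemma sorted_a_vec: "sorted (a_vec \<gamma>)"
proof (induction \<gamma> rule: rev_induct)
  case (snoc x \<gamma>)
  then show ?case using set_a_vec[of \<gamma>] by (auto simp: a_vec_snoc sorted_append)
qed simp

lemma count_a_vec:
  "count (mset (a_vec \<gamma>)) j = (if j \<in> {1..length \<gamma>} then \<gamma> ! (j - 1) else 0)"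
  by (induction \<gamma> rule: rev_induct) (auto simp: a_vec_snoc nth_append le_Suc_eq Suc_le_eq)

text \<open>Links counts of entries at most j to the partial sums in \<open>K_set\<close>.\<close>

lemma length_filter_a_vec: "length (filter (\<lambda>x. x \<le> j) (a_vec \<gamma>)) = sum_list (take j \<gamma>)"
  by (induction \<gamma> rule: rev_induct) (auto simp: a_vec_snoc filter_replicate not_le)

lemma prod_list_a_vec:
  "prod_list (map w (a_vec \<gamma>)) = (\<Prod>j = 1..length \<gamma>. (w j :: 'a :: comm_monoid_mult) ^ (\<gamma> ! (j - 1)))"
proof (induction \<gamma> rule: rev_induct)
  case (snoc x \<gamma>)
  show ?case unfolding prod_nth_snoc[of "\<lambda>j a. w j ^ a"] using snoc by (simp add: a_vec_snoc)
qed simp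

text \<open>Letters outside {1..k} are not recorded, hence the side condition on
  \<open>set b\<close> wherever the content is to determine the multiset.\<close>

definition content :: "nat \<Rightarrow> nat list \<Rightarrow> nat list" where
  "content k b = map (\<lambda>j. count (mset b) j) [1..<k + 1]"

lemma length_content [simp]: "length (content k b) = k"
  by (simp add: content_def)

text \<open>\<open>a_vec \<alpha>\<close> is the sorted word of content \<alpha>, so the words of
  that content are its rearrangements.\<close>

lemma mset_eq_a_vec_iff:
  assumes "length \<alpha> = k"
  shows "mset b = mset (a_vec \<alpha>) \<longleftrightarrow> set b \<subseteq> {1..k} \<and> content k b = \<alpha>"
proof
  assume b: "mset b = mset (a_vec \<alpha>)"
  then have "set b = set (a_vec \<alpha>)" by (metis set_mset_mset)
  moreover have "content k b = \<alpha>"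
    using assms b by (intro nth_equalityI) (auto simp: content_def count_a_vec simp del: count_mset upt_Suc)
  ultimately show "set b \<subseteq> {1..k} \<and> content k b = \<alpha>" using set_a_vec[of \<alpha>] assms by simp
next
  assume b: "set b \<subseteq> {1..k} \<and> content k b = \<alpha>"
  show "mset b = mset (a_vec \<alpha>)"
  proof (rule multiset_eqI)
    fix j
    have "count (mset b) j = 0" if "j \<notin> {1..k}"
      using that b by (metis count_eq_zero_iff set_mset_mset subsetD)
    moreover have "content k b ! (j - 1) = count (mset b) j" if "j \<in> {1..k}"
      using that by (auto simp: content_def simp del: count_mset upt_Suc)
    ultimately show "count (mset b) j = count (mset (a_vec \<alpha>)) j"
      using b by (auto simp: count_a_vec simp del: count_mset upt_Suc)
  qed
qed

text \<open>In a sorted list the entries at most j form an initial segment.\<close>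

lemma sorted_nth_le_iff:
  fixes xs :: "'a :: linorder list"
  assumes "sorted xs" "i < length xs"
  shows "xs ! i \<le> j \<longleftrightarrow> i < length (filter (\<lambda>x. x \<le> j) xs)"
  using assms
proof (induction xs arbitrary: i)
  case (Cons x xs)
  show ?case
  proof (cases "x \<le> j")
    case True
    with Cons show ?thesis by (cases i) auto
  next
    case False
    with Cons.prems have "\<forall>y \<in> set (x # xs). \<not> y \<le> j" by auto
    moreover have "(x # xs) ! i \<in> set (x # xs)" using Cons.prems by (intro nth_mem)
    ultimately show ?thesis using filter_False[of "x # xs" "\<lambda>y. y \<le> j"] by auto
  qed
qed simp

lemma length_filter_mset_cong: "mset xs = mset ys \<Longrightarrow> length (filter P xs) = length (filter P ys)"
  by (metis mset_filter size_mset)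

text \<open>Pointwise comparison of sorted lists is dual to comparison of their counting functions.
  Forwards, look at the last entry of \<open>a\<close> that is at most j; backwards, take j =
  \<open>a ! i\<close>.\<close>

lemma sort_nth_le_iff:
  fixes a b :: "'a :: linorder list"
  assumes "sorted a" "length b = length a"
  shows "(\<forall>i<length a. sort b ! i \<le> a ! i) \<longleftrightarrow>
    (\<forall>j. length (filter (\<lambda>x. x \<le> j) a) \<le> length (filter (\<lambda>x. x \<le> j) b))"
proof -
  have b: "length (filter (\<lambda>x. x \<le> j) (sort b)) = length (filter (\<lambda>x. x \<le> j) b)" for j
    by (rule length_filter_mset_cong) simp
  have sb: "sort b ! i \<le> j \<longleftrightarrow> i < length (filter (\<lambda>x. x \<le> j) b)" if "i < length a" for i j
    using sorted_nth_le_iff[of "sort b" i j] assms that b by simp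
  note sa = sorted_nth_le_iff[OF assms(1)]
  show ?thesis
  proof (intro iffI allI impI)
    fix j assume *: "\<forall>i<length a. sort b ! i \<le> a ! i"
    show "length (filter (\<lambda>x. x \<le> j) a) \<le> length (filter (\<lambda>x. x \<le> j) b)"
    proof (cases "length (filter (\<lambda>x. x \<le> j) a)")
      case (Suc i)
      then have "i < length a" using length_filter_le[of "\<lambda>x. x \<le> j" a] by linarith
      with Suc * sa[of i j] sb[of i j] show ?thesis by fastforce
    qed simp
  next
    fix i assume *: "\<forall>j. length (filter (\<lambda>x. x \<le> j) a) \<le> length (filter (\<lambda>x. x \<le> j) b)" and i: "i < length a"
    then show "sort b ! i \<le> a ! i" using sa[of i "a ! i"] sb[of i "a ! i"] by (metis order_refl order_less_le_trans)
  qed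
qed

text \<open>In the counting form of the parking condition both counts are partial sums, of \<gamma>
  and of the content, so the condition becomes the inequalities of \<open>K_set\<close>.\<close>

lemma parking_functions_a_vec:
  "parking_functions (a_vec \<gamma>) = {b. set b \<subseteq> {1..length \<gamma>} \<and> content (length \<gamma>) b \<in> K_set \<gamma>}"
proof (intro equalityI subsetI)
  let ?k = "length \<gamma>"
  have count: "length (filter (\<lambda>x. x \<le> j) b) = sum_list (take j (content ?k b))" if "set b \<subseteq> {1..?k}" for b j
  proof -
    have "mset b = mset (a_vec (content ?k b))" using that by (subst mset_eq_a_vec_iff) auto
    from length_filter_mset_cong[OF this] show ?thesis by (simp add: length_filter_a_vec)
  qed
  have total: "length b = sum_list (content ?k b)" if "set b \<subseteq> {1..?k}" for b
    using count[OF that, of ?k] that by (subst (asm) filter_True) auto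
  {
    fix b assume "b \<in> parking_functions (a_vec \<gamma>)"
    then have len: "length b = sum_list \<gamma>" and pos: "\<forall>x\<in>set b. 1 \<le> x"
      and "\<forall>i<length (a_vec \<gamma>). sort b ! i \<le> a_vec \<gamma> ! i"
      by (auto simp: parking_functions_def)
    then have le: "sum_list (take j \<gamma>) \<le> length (filter (\<lambda>x. x \<le> j) b)" for j
      using sort_nth_le_iff[OF sorted_a_vec, of b \<gamma>] by (simp add: length_filter_a_vec)
    \<comment> \<open>At j = k the partial sum of \<gamma> is the full length of b, so no entry of b
      can exceed k.\<close>
    have "\<forall>x\<in>set b. x \<le> ?k"
    proof (rule ccontr)
      assume "\<not> (\<forall>x\<in>set b. x \<le> ?k)"
      then have "length (filter (\<lambda>x. x \<le> ?k) b) < length b" by (auto intro: length_filter_less)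
      with le[of ?k] len show False by simp
    qed
    with pos have sub: "set b \<subseteq> {1..?k}" by auto
    moreover have "content ?k b \<in> K_set \<gamma>"
      using le len total[OF sub] by (simp add: K_set_def count[OF sub])
    ultimately show "b \<in> {b. set b \<subseteq> {1..?k} \<and> content ?k b \<in> K_set \<gamma>}" by simp
  next
    fix b assume "b \<in> {b. set b \<subseteq> {1..?k} \<and> content ?k b \<in> K_set \<gamma>}"
    then have sub: "set b \<subseteq> {1..?k}" and K: "content ?k b \<in> K_set \<gamma>" by auto
    have len: "length b = sum_list \<gamma>" using total[OF sub] K by (simp add: K_set_def)
    have "sum_list (take j \<gamma>) \<le> sum_list (take j (content ?k b))" for j
    proof (cases "j \<in> {1..?k}")
      case True
      then show ?thesis using K by (simp add: K_set_def)
    next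
      case False
      \<comment> \<open>Outside the range of \<open>K_set\<close> both partial sums are 0 or both
        are the equal totals.\<close>
      then have "j = 0 \<or> ?k < j" by auto
      then show ?thesis using K by (auto simp: K_set_def)
    qed
    then have "\<forall>i<length (a_vec \<gamma>). sort b ! i \<le> a_vec \<gamma> ! i"
      by (subst sort_nth_le_iff) (auto simp: sorted_a_vec len length_filter_a_vec count[OF sub])
    with len sub show "b \<in> parking_functions (a_vec \<gamma>)" by (auto simp: parking_functions_def)
  }
qed

text \<open>The fibre is the set of permutations of the multiset of \<open>a_vec \<alpha>\<close>,
  counted by the multinomial formula.\<close>

lemma card_content_fiber:
  assumes "length \<alpha> = k"
  shows "real (card {b. set b \<subseteq> {1..k} \<and> content k b = \<alpha>}) = multinomial (sum_list \<alpha>) \<alpha>"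
proof -
  have "{b. set b \<subseteq> {1..k} \<and> content k b = \<alpha>} = permutations_of_multiset (mset (a_vec \<alpha>))"
    using mset_eq_a_vec_iff[OF assms] by (auto simp: permutations_of_multiset_def)
  moreover have "(\<Prod>x\<in>set (a_vec \<alpha>). fact (count (mset (a_vec \<alpha>)) x) :: nat) = (\<Prod>i<k. fact (\<alpha> ! i))"
  proof -
    have "(\<Prod>x\<in>set (a_vec \<alpha>). fact (count (mset (a_vec \<alpha>)) x) :: nat)
        = (\<Prod>x\<in>{1..k}. fact (count (mset (a_vec \<alpha>)) x))"
    \<comment> \<open>Letters that do not occur contribute 0! = 1.\<close>
    proof (rule prod.mono_neutral_left)
      show "\<forall>x\<in>{1..k} - set (a_vec \<alpha>). fact (count (mset (a_vec \<alpha>)) x) = (1 :: nat)"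
      proof
        fix x assume "x \<in> {1..k} - set (a_vec \<alpha>)"
        then have "count (mset (a_vec \<alpha>)) x = 0" by (metis DiffD2 count_eq_zero_iff set_mset_mset)
        then show "fact (count (mset (a_vec \<alpha>)) x) = (1 :: nat)" by (simp only: fact_0)
      qed
    qed (use set_a_vec[of \<alpha>] assms in auto)
    also have "\<dots> = (\<Prod>x\<in>{1..k}. fact (\<alpha> ! (x - 1)))"
      using assms by (intro prod.cong) (auto simp: count_a_vec simp del: count_mset upt_Suc)
    also have "\<dots> = (\<Prod>i<k. fact (\<alpha> ! i))"
      by (rule prod.reindex_bij_witness[of _ Suc "\<lambda>x. x - 1"]) auto
    finally show ?thesis .
  qed
  ultimately have "card {b. set b \<subseteq> {1..k} \<and> content k b = \<alpha>} * (\<Prod>i<k. fact (\<alpha> ! i)) = fact (sum_list \<alpha>)"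
    using card_permutations_of_multiset_aux[of "mset (a_vec \<alpha>)"] by (simp del: count_mset upt_Suc)
  then have "real (card {b. set b \<subseteq> {1..k} \<and> content k b = \<alpha>}) * (\<Prod>i<k. fact (\<alpha> ! i)) = fact (sum_list \<alpha>)"
    by (metis (mono_tags, lifting) of_nat_fact of_nat_mult of_nat_prod prod.cong)
  then show ?thesis
    using assms by (simp add: multinomial_def eq_divide_eq)
qed

text \<open>A product of letter weights depends only on the content, so the sum is grouped by
  content and each fibre contributes its cardinality.\<close>

lemma sum_parking_functions_a_vec:
  fixes w :: "nat \<Rightarrow> real"
  shows "(\<Sum>b\<in>parking_functions (a_vec \<gamma>). \<Prod>i<sum_list \<gamma>. w (b ! i))
    = (\<Sum>\<alpha>\<in>K_set \<gamma>. multinomial (sum_list \<gamma>) \<alpha> * (\<Prod>j = 1..length \<gamma>. w j ^ (\<alpha> ! (j - 1))))"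
proof -
  let ?k = "length \<gamma>"
  have "(\<Sum>b\<in>parking_functions (a_vec \<gamma>). \<Prod>i<sum_list \<gamma>. w (b ! i))
    = (\<Sum>\<alpha>\<in>K_set \<gamma>. \<Sum>b | b \<in> parking_functions (a_vec \<gamma>) \<and> content ?k b = \<alpha>. \<Prod>i<sum_list \<gamma>. w (b ! i))"
    by (rule sum.group[symmetric]) (auto simp: finite_parking_functions finite_K_set, auto simp: parking_functions_a_vec)
  also have "\<dots> = (\<Sum>\<alpha>\<in>K_set \<gamma>. multinomial (sum_list \<gamma>) \<alpha> * (\<Prod>j = 1..?k. w j ^ (\<alpha> ! (j - 1))))"
  proof (rule sum.cong[OF refl])
    fix \<alpha> assume \<alpha>: "\<alpha> \<in> K_set \<gamma>"
    then have len: "length \<alpha> = ?k" and total: "sum_list \<alpha> = sum_list \<gamma>" by (auto simp: K_set_def)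
    have fiber: "{b. b \<in> parking_functions (a_vec \<gamma>) \<and> content ?k b = \<alpha>} = {b. set b \<subseteq> {1..?k} \<and> content ?k b = \<alpha>}"
      using \<alpha> by (auto simp: parking_functions_a_vec)
    have "(\<Prod>i<sum_list \<gamma>. w (b ! i)) = (\<Prod>j = 1..?k. w j ^ (\<alpha> ! (j - 1)))"
      if "b \<in> {b. set b \<subseteq> {1..?k} \<and> content ?k b = \<alpha>}" for b
    proof -
      from that have b: "mset b = mset (a_vec \<alpha>)" using mset_eq_a_vec_iff[OF len] by simp
      then have "length b = sum_list \<gamma>" by (metis total length_a_vec size_mset)
      then have "(\<Prod>i<sum_list \<gamma>. w (b ! i)) = prod_list (map w b)"
        by (simp add: prod.list_conv_set_nth lessThan_atLeast0)
      also have "\<dots> = prod_list (map w (a_vec \<alpha>))"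
        using b by (metis mset_map prod_mset_prod_list)
      finally show ?thesis by (simp add: prod_list_a_vec len)
    qed
    then show "(\<Sum>b | b \<in> parking_functions (a_vec \<gamma>) \<and> content ?k b = \<alpha>. \<Prod>i<sum_list \<gamma>. w (b ! i))
       = multinomial (sum_list \<gamma>) \<alpha> * (\<Prod>j = 1..?k. w j ^ (\<alpha> ! (j - 1)))"
      unfolding fiber using card_content_fiber[OF len] total by simp
  qed
  finally show ?thesis .
qed

text \<open>Only odd j contribute a sign.\<close>

lemma prod_signed_power:
  "(\<Prod>j = 1..length \<alpha>. ((- 1) ^ j * d j) ^ (\<alpha> ! (j - 1)))
    = (- 1) ^ odd_sum \<alpha> * (\<Prod>j = 1..length \<alpha>. (d j :: real) ^ (\<alpha> ! (j - 1)))"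
proof (induction \<alpha> rule: rev_induct)
  case (snoc x \<alpha>)
  let ?m = "Suc (length \<alpha>)"
  have "((- 1) ^ ?m * d ?m) ^ x = (- 1) ^ (if even (length \<alpha>) then x else 0) * d ?m ^ x"
    by (simp add: power_minus[of "d ?m"])
  then show ?case
    unfolding prod_nth_snoc[of "\<lambda>j a. ((- 1) ^ j * d j) ^ a"] prod_nth_snoc[of "\<lambda>j a. d j ^ a"]
      odd_sum_snoc power_add snoc by (simp only: mult_ac)
qed simp

section \<open>From the set S to its composition, and assembly of the formula\<close>

lemma length_alternating_word: "length (alternating_word x y ms) = sum_list ms"
  by (induction ms arbitrary: x y) auto

text \<open>Since 1 is not in S, the definite description in \<open>comp_of\<close> is legitimate;
  the total follows from comparing the lengths of the two words, n - 1 on one side.\<close>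

lemma comp_of_properties:
  assumes "n \<ge> 1" "S \<subseteq> {2..n - 1}" "comp_of n S = 1 # \<delta>"
  shows "\<forall>m\<in>set \<delta>. 1 \<le> m" and "n = 1 + sum_list \<delta>"
proof -
  have "1 \<notin> S" using assms(2) by auto
  from theI'[OF comp_of_well_defined[OF this, of n]] assms(3)
  have \<delta>: "(\<forall>m\<in>set \<delta>. 1 \<le> m) \<and> u_word n S = alternating_word Letter_a Letter_b \<delta>"
    by (simp add: comp_of_def)
  then show "\<forall>m\<in>set \<delta>. 1 \<le> m" by simp
  have "length (u_word n S) = sum_list \<delta>"
    using \<delta> by (simp add: length_alternating_word)
  with assms(1) show "n = 1 + sum_list \<delta>" by (simp add: u_word_def)
qed

text \<open>Prepending 1 shifts positions by one: the odd positions of \<open>1 # \<delta>\<close>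
  are the first one and the successors of the even positions of \<delta>.\<close>

lemma sign_comp:
  "(- 1 :: real) ^ (1 + (\<Sum>j | j \<in> {1..length \<delta>} \<and> even j. \<delta> ! (j - 1))) = (- 1) ^ odd_sum (1 # \<delta>)"
proof -
  have "odd_sum (1 # \<delta>) = 1 + (\<Sum>j | j \<in> {1..length \<delta>} \<and> even j. \<delta> ! (j - 1))"
  proof -
    have "{j. j \<in> {1..length (1 # \<delta>)} \<and> odd j} = insert 1 (Suc ` {j. j \<in> {1..length \<delta>} \<and> even j})"
    proof (intro equalityI subsetI)
      fix j assume j: "j \<in> {j. j \<in> {1..length (1 # \<delta>)} \<and> odd j}"
      then obtain i where "j = Suc i" by (cases j) auto
      with j show "j \<in> insert 1 (Suc ` {j. j \<in> {1..length \<delta>} \<and> even j})" by (cases i) auto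
    qed auto
    moreover have "(\<Sum>j \<in> insert 1 (Suc ` {j. j \<in> {1..length \<delta>} \<and> even j}). (1 # \<delta>) ! (j - 1))
        = 1 + (\<Sum>j | j \<in> {1..length \<delta>} \<and> even j. (1 # \<delta>) ! j)"
      by (subst sum.insert) (auto simp: sum.reindex)
    moreover have "(\<Sum>j | j \<in> {1..length \<delta>} \<and> even j. (1 # \<delta>) ! j) = (\<Sum>j | j \<in> {1..length \<delta>} \<and> even j. \<delta> ! (j - 1))"
      by (intro sum.cong) (auto simp: nth_Cons')
    ultimately show ?thesis by (simp only: odd_sum_def)
  qed
  then show ?thesis by simp
qed

lemma fact_mult_measure_chain_polytope:
  assumes "\<forall>g\<in>set \<delta>. g \<ge> 1" and "0 \<le> d 1" and "\<forall>i\<in>{1..length \<delta>}. d i \<le> d (i + 1)"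
  shows "fact (1 + sum_list \<delta>) * measure (Pi\<^sub>M {1..1 + sum_list \<delta>} (\<lambda>_. lborel)) (chain_polytope \<delta> d)
    = (- 1) ^ odd_sum (1 # \<delta>) * (\<Sum>\<alpha>\<in>K_set (1 # \<delta>). multinomial (1 + sum_list \<delta>) \<alpha> * (- 1) ^ odd_sum \<alpha> *
        (\<Prod>j = 1..length (1 # \<delta>). d j ^ (\<alpha> ! (j - 1))))"
proof -
  have dpos: "0 \<le> d (i + 1)" if "i \<le> length \<delta>" for i
    using that
  proof (induction i)
    case (Suc i)
    then show ?case using assms(3)[rule_format, of "i + 1"] by auto
  qed (use assms in simp)
  \<comment> \<open>Splits off the last part g of the composition, which exists even when \<delta>
    is empty because of the leading 1.\<close>
  obtain g gs where ggs: "rev (1 # \<delta>) = g # gs" by (cases "rev (1 # \<delta>)") auto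
  then have eq: "1 # \<delta> = rev gs @ [g]" by (metis rev_rev_ident rev.simps(2))
  then have len: "length \<delta> = length gs" by (metis length_Cons length_append_singleton length_rev nat.inject)
  have g: "\<forall>g\<in>set (g # gs). g \<ge> 1" using assms(1) unfolding ggs[symmetric] by auto
  have "measure (Pi\<^sub>M {1..1 + sum_list \<delta>} (\<lambda>_. lborel)) (chain_polytope \<delta> d)
      = run_density d (g # gs) (Suc 0) (d (length gs + 1))"
    using measure_chain_polytope[OF assms(1), of d] dpos[of "length \<delta>"] unfolding ggs len by simp
  \<comment> \<open>At the last bound itself only the term j = 0 survives. The last block now
    appears as an open one with R = g, so that the index set becomes
    \<open>K_set (1 # \<delta>)\<close>.\<close>
  also have "\<dots> = run_density d gs (Suc g) (d (length gs + 1))"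
    using run_density_beyond[of g d gs "d (length gs + 1)" 0] g dpos[of "length \<delta>"] len by simp
  also have "\<dots> = (\<Sum>\<alpha>\<in>K_set (1 # \<delta>). (- 1) ^ (odd_sum (1 # \<delta>) + odd_sum \<alpha>) *
       (\<Prod>j = 1..length \<alpha>. d j ^ (\<alpha> ! (j - 1)) / fact (\<alpha> ! (j - 1))))"
    using run_density_eq_sum_K_set[of gs d g] g assms(2,3) unfolding eq len by simp
  finally have m: "measure (Pi\<^sub>M {1..1 + sum_list \<delta>} (\<lambda>_. lborel)) (chain_polytope \<delta> d) = \<dots>" .
  show ?thesis
    unfolding m sum_distrib_left
  proof (rule sum.cong[OF refl])
    fix \<alpha> assume "\<alpha> \<in> K_set (1 # \<delta>)"
    then have len: "length \<alpha> = length (1 # \<delta>)" by (simp add: K_set_def)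
    have "(\<Prod>j = 1..length \<alpha>. fact (\<alpha> ! (j - 1)) :: real) = (\<Prod>i<length \<alpha>. fact (\<alpha> ! i))"
      by (rule prod.reindex_bij_witness[of _ Suc "\<lambda>x. x - 1"]) auto
    then show "fact (1 + sum_list \<delta>) * ((- 1) ^ (odd_sum (1 # \<delta>) + odd_sum \<alpha>) *
       (\<Prod>j = 1..length \<alpha>. d j ^ (\<alpha> ! (j - 1)) / fact (\<alpha> ! (j - 1))))
      = (- 1) ^ odd_sum (1 # \<delta>) * (multinomial (1 + sum_list \<delta>) \<alpha> * (- 1) ^ odd_sum \<alpha> *
        (\<Prod>j = 1..length (1 # \<delta>). d j ^ (\<alpha> ! (j - 1))))"
      unfolding multinomial_def prod_dividef power_add len[symmetric] by simp
  qed
qed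

theorem theorem3p1:
  fixes n k :: nat and S :: "nat set" and \<delta> :: "nat list" and d :: "nat \<Rightarrow> real"
  assumes "n \<ge> 1"
    and "S \<subseteq> {2..n - 1}"
    and "comp_of n S = 1 # \<delta>"
    and "k = length (comp_of n S)"
    and "0 < d 1"
    and "\<forall>i\<in>{1..<k}. d i \<le> d (i + 1)"
  shows "fact n * measure (lebesgue_n n) (Z_polytope n S d)
           = (- 1) ^ (1 + (\<Sum>j | j \<in> {1..k - 1} \<and> even j. \<delta> ! (j - 1)))
             * (\<Sum>b\<in>parking_functions (a_vec (comp_of n S)).
                  \<Prod>i<n. (- 1) ^ (b ! i) * d (b ! i))
       \<and> (- 1) ^ (1 + (\<Sum>j | j \<in> {1..k - 1} \<and> even j. \<delta> ! (j - 1)))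
             * (\<Sum>b\<in>parking_functions (a_vec (comp_of n S)).
                  \<Prod>i<n. (- 1) ^ (b ! i) * d (b ! i))
           = (- 1) ^ (1 + (\<Sum>j | j \<in> {1..k - 1} \<and> even j. \<delta> ! (j - 1)))
             * (\<Sum>\<alpha>\<in>K_set (comp_of n S).
                  multinomial n \<alpha>
                  * (- 1) ^ (\<Sum>j | j \<in> {1..k} \<and> odd j. \<alpha> ! (j - 1))
                  * (\<Prod>j = 1..k. d j ^ (\<alpha> ! (j - 1))))"
proof -
  note pos = comp_of_properties(1)[OF assms(1-3)] and n = comp_of_properties(2)[OF assms(1-3)]
  have k: "k = length (1 # \<delta>)" "k - 1 = length \<delta>" using assms(3,4) by simp_all
  have Z: "Z_polytope n S d = chain_polytope \<delta> d"
    by (simp only: Z_polytope_def chain_polytope_def assms(3) Let_def list.sel n[symmetric])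
  have odd: "(\<Sum>j | j \<in> {1..k} \<and> odd j. \<alpha> ! (j - 1)) = odd_sum \<alpha>" if "\<alpha> \<in> K_set (1 # \<delta>)" for \<alpha>
    using that k(1) by (simp add: odd_sum_def K_set_def)
  have K: "(\<Sum>\<alpha>\<in>K_set (comp_of n S). multinomial n \<alpha>
        * (- 1) ^ (\<Sum>j | j \<in> {1..k} \<and> odd j. \<alpha> ! (j - 1)) * (\<Prod>j = 1..k. d j ^ (\<alpha> ! (j - 1))))
      = (\<Sum>\<alpha>\<in>K_set (1 # \<delta>). multinomial n \<alpha> * (- 1) ^ odd_sum \<alpha> * (\<Prod>j = 1..k. d j ^ (\<alpha> ! (j - 1))))"
    unfolding assms(3) by (intro sum.cong refl) (simp only: odd)
  have P: "(\<Sum>b\<in>parking_functions (a_vec (comp_of n S)). \<Prod>i<n. (- 1) ^ (b ! i) * d (b ! i))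
      = (\<Sum>\<alpha>\<in>K_set (1 # \<delta>). multinomial n \<alpha> * (- 1) ^ odd_sum \<alpha> * (\<Prod>j = 1..k. d j ^ (\<alpha> ! (j - 1))))"
  proof -
    have "(\<Sum>b\<in>parking_functions (a_vec (comp_of n S)). \<Prod>i<n. (- 1) ^ (b ! i) * d (b ! i))
        = (\<Sum>\<alpha>\<in>K_set (1 # \<delta>). multinomial n \<alpha> * (\<Prod>j = 1..k. ((- 1) ^ j * d j) ^ (\<alpha> ! (j - 1))))"
      \<comment> \<open>The letter j is given the weight (-1)^j d_j.\<close>
      using sum_parking_functions_a_vec[of "\<lambda>j. (- 1) ^ j * d j" "1 # \<delta>"] n k(1) assms(3) by simp
    also have "\<dots> = (\<Sum>\<alpha>\<in>K_set (1 # \<delta>). multinomial n \<alpha> * (- 1) ^ odd_sum \<alpha> * (\<Prod>j = 1..k. d j ^ (\<alpha> ! (j - 1))))"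
    proof (rule sum.cong[OF refl])
      fix \<alpha> assume "\<alpha> \<in> K_set (1 # \<delta>)"
      then have "k = length \<alpha>" using k(1) by (simp add: K_set_def)
      then show "multinomial n \<alpha> * (\<Prod>j = 1..k. ((- 1) ^ j * d j) ^ (\<alpha> ! (j - 1)))
          = multinomial n \<alpha> * (- 1) ^ odd_sum \<alpha> * (\<Prod>j = 1..k. d j ^ (\<alpha> ! (j - 1)))"
        by (simp only: prod_signed_power mult.assoc)
    qed
    finally show ?thesis .
  qed
  have vol: "fact n * measure (lebesgue_n n) (Z_polytope n S d) = (- 1) ^ odd_sum (1 # \<delta>) *
      (\<Sum>\<alpha>\<in>K_set (1 # \<delta>). multinomial n \<alpha> * (- 1) ^ odd_sum \<alpha> * (\<Prod>j = 1..k. d j ^ (\<alpha> ! (j - 1))))"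
  proof -
    have "\<forall>i\<in>{1..length \<delta>}. d i \<le> d (i + 1)" using assms(6) k by auto
    from fact_mult_measure_chain_polytope[OF pos less_imp_le[OF assms(5)] this]
    show ?thesis unfolding Z lebesgue_n_def n[symmetric] k(1)[symmetric] .
  qed
  show ?thesis
    unfolding K P vol k(2) sign_comp by simp
qed

end
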